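(* Let $(M,\varphi,\xi,\eta,g)$ be a three-dimensional paracontact metric manifold. Then the Reeb vector field $\xi$ is an infinitesimal harmonic transformation if and only if the manifold is locally described, with respect to a local $\varphi$-basis $\{\xi,e,\varphi e\}$, by $$[\xi,e]=-\varepsilon a_1 e+(a_3-a_1+1)\varphi e,\quad [\xi,\varphi e]=(a_3+a_1+1)e+\varepsilon a_1\varphi e,\quad [e,\varphi e]=-2\xi+a_4e-a_5\varphi e,$$ for some $\varepsilon\in\{1,-1\}$ and some smooth functions $a_1,a_3,a_4,a_5$ satisfying $$\xi(a_4)-e(a_3)+\varepsilon a_1a_4-a_5(a_3-a_1+1)=0,$$ $$\xi(a_5)-\varphi e(a_3)-\varepsilon a_1a_5-a_4(a_3+a_1+1)=0,$$ $$(e+\varepsilon\varphi e)(a_1)+2\varepsilon a_1a_4+2a_1a_5=0.$$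
   Context: An almost paracontact structure on a connected smooth manifold $M$ of dimension $3$ is a triple $(\varphi,\xi,\eta)$ of a $(1,1)$-tensor, a global vector field and a $1$-form with $\varphi(\xi)=0$, $\eta\circ\varphi=0$, $\eta(\xi)=1$, $\varphi^2=\mathrm{Id}-\eta\otimes\xi$, and such that the $\pm1$-eigenbundles of $\varphi|_{\ker\eta}$ both have rank $1$. A pseudo-Riemannian metric $g$ is compatible if $g(\varphi X,\varphi Y)=-g(X,Y)+\eta(X)\eta(Y)$; then $(\varphi,\xi,\eta,g)$ is an almost paracontact metric structure, $\eta=g(\xi,\cdot)$, and $g$ has signature $(2,1)$. It is a paracontact metric structure if $d\eta(X,Y)=g(X,\varphi Y)$ for all $X,Y$, with the convention $d\eta(X,Y)=\frac12\big(X\eta(Y)-Y\eta(X)-\eta([X,Y])\big)$. $\xi$ is called the Reeb vector field. A (local) $\varphi$-basis is a pseudo-orthonormal local frame $\{\xi,e,\varphi e\}$ with $\xi,e$ space-like unit and $\varphi e$ time-like unit. For a vector field $V$, $(\mathcal L_V\nabla)(X,Y)=\mathcal L_V(\nabla_XY)-\nabla_{\mathcal L_VX}Y-\nabla_X(\mathcal L_VY)$, where $\nabla$ is the Levi-Civita connection. $V$ is an infinitesimal harmonic transformation if the $g$-trace $\mathrm{tr}(\mathcal L_V\nabla)$ vanishes (in a $\varphi$-basis, $(\mathcal L_V\nabla)(\xi,\xi)+(\mathcal L_V\nabla)(e,e)-(\mathcal L_V\nabla)(\varphi e,\varphi e)=0$).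
   Formalization: The sign ε is not one constant near each point but a {1,-1}-valued function, locally constant on a dense open subset of the neighbourhood; with a constant ε the "only if" part fails for some smooth (non-analytic) structures. *)

theory Defs
  imports "HOL-Analysis.Analysis" "HOL-Library.Function_Algebras"
begin

text \<open>
  The pointwise real vector space structure on functions, so that tangent vectors, which are
  real-valued operators on functions, can be added and scaled.
\<close>

instantiation "fun" :: (type, real_vector) real_vector
begin

definition scaleR_fun_def: "c *\<^sub>R f = (\<lambda>x. c *\<^sub>R f x)"

instance
  by standard (simp_all add: scaleR_fun_def plus_fun_def scaleR_add_right scaleR_add_left)

end


section \<open>Smooth 3-manifolds\<close>

text \<open>Only meant for open \<open>S\<close>: derivatives are taken at points, not within \<open>S\<close>.\<close>

fun Ck_on :: "nat \<Rightarrow> (real^3) set \<Rightarrow> (real^3 \<Rightarrow> 'b::real_normed_vector) \<Rightarrow> bool" where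
  "Ck_on 0 S f \<longleftrightarrow> continuous_on S f"
| "Ck_on (Suc k) S f \<longleftrightarrow>
     (\<forall>x\<in>S. f differentiable (at x)) \<and> (\<forall>v. Ck_on k S (\<lambda>x. frechet_derivative f (at x) v))"

definition smooth_on :: "(real^3) set \<Rightarrow> (real^3 \<Rightarrow> 'b::real_normed_vector) \<Rightarrow> bool" where
  "smooth_on S f \<longleftrightarrow> (\<forall>k. Ck_on k S f)"

type_synonym 'a chart = "'a set \<times> ('a \<Rightarrow> real^3)"

text \<open>The manifold is the whole type; Hausdorff and second countable come from its sort.\<close>

definition smooth_atlas :: "('a::{t2_space,second_countable_topology}) chart set \<Rightarrow> bool" where
  "smooth_atlas A \<longleftrightarrow>
     (\<Union>(U,\<kappa>)\<in>A. U) = UNIV \<and>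
     (\<forall>(U,\<kappa>)\<in>A. open U \<and> open (\<kappa> ` U) \<and> homeomorphism U (\<kappa> ` U) \<kappa> (inv_into U \<kappa>)) \<and>
     (\<forall>(U,\<kappa>)\<in>A. \<forall>(V,\<mu>)\<in>A. smooth_on (\<kappa> ` (U \<inter> V)) (\<mu> \<circ> inv_into U \<kappa>))"

definition smooth_fun ::
    "('a::{t2_space,second_countable_topology}) chart set \<Rightarrow> 'a set \<Rightarrow> ('a \<Rightarrow> real) \<Rightarrow> bool" where
  "smooth_fun A W f \<longleftrightarrow> (\<forall>(U,\<kappa>)\<in>A. smooth_on (\<kappa> ` (U \<inter> W)) (f \<circ> inv_into U \<kappa>))"

definition smooth_at ::
    "('a::{t2_space,second_countable_topology}) chart set \<Rightarrow> 'a \<Rightarrow> ('a \<Rightarrow> real) \<Rightarrow> bool" where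
  "smooth_at A p f \<longleftrightarrow> (\<exists>W. open W \<and> p \<in> W \<and> smooth_fun A W f)"


section \<open>Tangent vectors and tensor fields\<close>

text \<open>
  A tangent vector at \<open>p\<close> is the operator of directional derivative at \<open>p\<close>, acting on the
  functions smooth near \<open>p\<close>.  It is set to 0 on all other functions, so that equality of tangent
  vectors is equality of operators.
\<close>

type_synonym 'a tvec = "('a \<Rightarrow> real) \<Rightarrow> real"
type_synonym 'a vfield = "'a \<Rightarrow> 'a tvec"

definition dir_deriv ::
    "('a::{t2_space,second_countable_topology}) chart set \<Rightarrow> 'a chart \<Rightarrow> 'a \<Rightarrow> real^3 \<Rightarrow> 'a tvec" where
  "dir_deriv A = (\<lambda>(U,\<kappa>) p w f.
     if smooth_at A p f then frechet_derivative (f \<circ> inv_into U \<kappa>) (at (\<kappa> p)) w else 0)"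

definition tangent_space ::
    "('a::{t2_space,second_countable_topology}) chart set \<Rightarrow> 'a \<Rightarrow> 'a tvec set" where
  "tangent_space A p = {dir_deriv A c p w | c w. c \<in> A \<and> p \<in> fst c}"

definition smooth_vfield ::
    "('a::{t2_space,second_countable_topology}) chart set \<Rightarrow> 'a set \<Rightarrow> 'a vfield \<Rightarrow> bool" where
  "smooth_vfield A U X \<longleftrightarrow>
     (\<forall>p\<in>U. X p \<in> tangent_space A p) \<and>
     (\<forall>W f. open W \<and> W \<subseteq> U \<and> smooth_fun A W f \<longrightarrow> smooth_fun A W (\<lambda>p. X p f))"

definition lie_bracket ::
    "('a::{t2_space,second_countable_topology}) chart set \<Rightarrow> 'a vfield \<Rightarrow> 'a vfield \<Rightarrow> 'a vfield" where
  "lie_bracket A X Y = (\<lambda>p f.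
     if smooth_at A p f then X p (\<lambda>q. Y q f) - Y p (\<lambda>q. X q f) else 0)"

definition one_form ::
    "('a::{t2_space,second_countable_topology}) chart set \<Rightarrow> ('a \<Rightarrow> 'a tvec \<Rightarrow> real) \<Rightarrow> bool" where
  "one_form A \<eta> \<longleftrightarrow>
     (\<forall>p. \<forall>v\<in>tangent_space A p. \<forall>w\<in>tangent_space A p. \<forall>c.
        \<eta> p (v + w) = \<eta> p v + \<eta> p w \<and> \<eta> p (c *\<^sub>R v) = c * \<eta> p v) \<and>
     (\<forall>U X. open U \<and> smooth_vfield A U X \<longrightarrow> smooth_fun A U (\<lambda>p. \<eta> p (X p)))"

definition tensor11 ::
    "('a::{t2_space,second_countable_topology}) chart set \<Rightarrow> ('a \<Rightarrow> 'a tvec \<Rightarrow> 'a tvec) \<Rightarrow> bool" where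
  "tensor11 A \<phi> \<longleftrightarrow>
     (\<forall>p. \<forall>v\<in>tangent_space A p. \<phi> p v \<in> tangent_space A p) \<and>
     (\<forall>p. \<forall>v\<in>tangent_space A p. \<forall>w\<in>tangent_space A p. \<forall>c.
        \<phi> p (v + w) = \<phi> p v + \<phi> p w \<and> \<phi> p (c *\<^sub>R v) = c *\<^sub>R \<phi> p v) \<and>
     (\<forall>U X. open U \<and> smooth_vfield A U X \<longrightarrow> smooth_vfield A U (\<lambda>p. \<phi> p (X p)))"

definition pseudo_riemannian_metric ::
    "('a::{t2_space,second_countable_topology}) chart set \<Rightarrow>
     ('a \<Rightarrow> 'a tvec \<Rightarrow> 'a tvec \<Rightarrow> real) \<Rightarrow> bool" where
  "pseudo_riemannian_metric A g \<longleftrightarrow>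
     (\<forall>p. \<forall>u\<in>tangent_space A p. \<forall>v\<in>tangent_space A p. \<forall>w\<in>tangent_space A p. \<forall>c.
        g p u v = g p v u \<and> g p (u + v) w = g p u w + g p v w \<and> g p (c *\<^sub>R u) v = c * g p u v) \<and>
     (\<forall>p. \<forall>v\<in>tangent_space A p. (\<forall>w\<in>tangent_space A p. g p v w = 0) \<longrightarrow> v = 0) \<and>
     (\<forall>U X Y. open U \<and> smooth_vfield A U X \<and> smooth_vfield A U Y \<longrightarrow>
        smooth_fun A U (\<lambda>p. g p (X p) (Y p)))"

text \<open>The convention for the exterior derivative of a 1-form has the factor 1/2.\<close>

definition ext_d ::
    "('a::{t2_space,second_countable_topology}) chart set \<Rightarrow> ('a \<Rightarrow> 'a tvec \<Rightarrow> real) \<Rightarrow>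
     'a vfield \<Rightarrow> 'a vfield \<Rightarrow> 'a \<Rightarrow> real" where
  "ext_d A \<eta> X Y p =
     (X p (\<lambda>q. \<eta> q (Y q)) - Y p (\<lambda>q. \<eta> q (X q)) - \<eta> p (lie_bracket A X Y p)) / 2"


section \<open>Levi-Civita connection and harmonic transformations\<close>

text \<open>
  A connection is taken as an operator on local vector fields.  As the axioms are imposed on every
  open set, the value of \<open>nabla X Y\<close> at a point depends only on the germs of \<open>X\<close> and \<open>Y\<close> there.
\<close>

definition affine_connection ::
    "('a::{t2_space,second_countable_topology}) chart set \<Rightarrow>
     ('a vfield \<Rightarrow> 'a vfield \<Rightarrow> 'a vfield) \<Rightarrow> bool" where
  "affine_connection A nabla \<longleftrightarrow>
     (\<forall>U X Y Z f. open U \<and> smooth_vfield A U X \<and> smooth_vfield A U Y \<and> smooth_vfield A U Z \<and>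
        smooth_fun A U f \<longrightarrow>
        smooth_vfield A U (nabla X Y) \<and>
        (\<forall>p\<in>U. nabla (\<lambda>q. X q + Z q) Y p = nabla X Y p + nabla Z Y p \<and>
               nabla (\<lambda>q. f q *\<^sub>R X q) Y p = f p *\<^sub>R nabla X Y p \<and>
               nabla X (\<lambda>q. Y q + Z q) p = nabla X Y p + nabla X Z p \<and>
               nabla X (\<lambda>q. f q *\<^sub>R Y q) p = X p f *\<^sub>R Y p + f p *\<^sub>R nabla X Y p))"

definition levi_civita ::
    "('a::{t2_space,second_countable_topology}) chart set \<Rightarrow>
     ('a \<Rightarrow> 'a tvec \<Rightarrow> 'a tvec \<Rightarrow> real) \<Rightarrow>
     ('a vfield \<Rightarrow> 'a vfield \<Rightarrow> 'a vfield) \<Rightarrow> bool" where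
  "levi_civita A g nabla \<longleftrightarrow>
     affine_connection A nabla \<and>
     (\<forall>U X Y Z. open U \<and> smooth_vfield A U X \<and> smooth_vfield A U Y \<and> smooth_vfield A U Z \<longrightarrow>
        (\<forall>p\<in>U. nabla X Y p - nabla Y X p = lie_bracket A X Y p \<and>
               X p (\<lambda>q. g q (Y q) (Z q)) = g p (nabla X Y p) (Z p) + g p (Y p) (nabla X Z p)))"

definition lie_deriv_connection ::
    "('a::{t2_space,second_countable_topology}) chart set \<Rightarrow>
     ('a vfield \<Rightarrow> 'a vfield \<Rightarrow> 'a vfield) \<Rightarrow> 'a vfield \<Rightarrow> 'a vfield \<Rightarrow> 'a vfield \<Rightarrow> 'a vfield" where
  "lie_deriv_connection A nabla V X Y = (\<lambda>p.
     lie_bracket A V (nabla X Y) p - nabla (lie_bracket A V X) Y p - nabla X (lie_bracket A V Y) p)"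

definition pseudo_orthonormal_frame ::
    "('a::{t2_space,second_countable_topology}) chart set \<Rightarrow>
     ('a \<Rightarrow> 'a tvec \<Rightarrow> 'a tvec \<Rightarrow> real) \<Rightarrow> 'a set \<Rightarrow> (3 \<Rightarrow> 'a vfield) \<Rightarrow> (3 \<Rightarrow> real) \<Rightarrow> bool" where
  "pseudo_orthonormal_frame A g U E s \<longleftrightarrow>
     open U \<and> (\<forall>i. smooth_vfield A U (E i)) \<and> (\<forall>i. s i \<in> {1, -1}) \<and>
     (\<forall>p\<in>U. \<forall>i j. g p (E i p) (E j p) = (if i = j then s i else 0))"

text \<open>
  The \<open>g\<close>-trace of the tensor \<open>lie_deriv_connection A nabla V\<close> vanishes; the trace is computed in
  local pseudo-orthonormal frames, with the signs \<open>s\<close> of the frame vectors.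
\<close>

definition infinitesimal_harmonic_transformation ::
    "('a::{t2_space,second_countable_topology}) chart set \<Rightarrow>
     ('a \<Rightarrow> 'a tvec \<Rightarrow> 'a tvec \<Rightarrow> real) \<Rightarrow>
     ('a vfield \<Rightarrow> 'a vfield \<Rightarrow> 'a vfield) \<Rightarrow> 'a vfield \<Rightarrow> bool" where
  "infinitesimal_harmonic_transformation A g nabla V \<longleftrightarrow>
     (\<forall>U E s. pseudo_orthonormal_frame A g U E s \<longrightarrow>
        (\<forall>p\<in>U. (\<Sum>i\<in>UNIV. s i *\<^sub>R lie_deriv_connection A nabla V (E i) (E i) p) = 0))"


section \<open>Paracontact metric structures\<close>

definition almost_paracontact ::
    "('a::{t2_space,second_countable_topology}) chart set \<Rightarrow> ('a \<Rightarrow> 'a tvec \<Rightarrow> 'a tvec) \<Rightarrow>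
     'a vfield \<Rightarrow> ('a \<Rightarrow> 'a tvec \<Rightarrow> real) \<Rightarrow> bool" where
  "almost_paracontact A \<phi> \<xi> \<eta> \<longleftrightarrow>
     tensor11 A \<phi> \<and> smooth_vfield A UNIV \<xi> \<and> one_form A \<eta> \<and>
     (\<forall>p. \<phi> p (\<xi> p) = 0 \<and> \<eta> p (\<xi> p) = 1 \<and>
        (\<forall>v\<in>tangent_space A p. \<eta> p (\<phi> p v) = 0 \<and> \<phi> p (\<phi> p v) = v - \<eta> p v *\<^sub>R \<xi> p) \<and>
        dim {v \<in> tangent_space A p. \<eta> p v = 0 \<and> \<phi> p v = v} = 1 \<and>
        dim {v \<in> tangent_space A p. \<eta> p v = 0 \<and> \<phi> p v = - v} = 1)"

definition paracontact_metric_manifold ::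
    "('a::{t2_space,second_countable_topology}) chart set \<Rightarrow> ('a \<Rightarrow> 'a tvec \<Rightarrow> 'a tvec) \<Rightarrow>
     'a vfield \<Rightarrow> ('a \<Rightarrow> 'a tvec \<Rightarrow> real) \<Rightarrow> ('a \<Rightarrow> 'a tvec \<Rightarrow> 'a tvec \<Rightarrow> real) \<Rightarrow> bool" where
  "paracontact_metric_manifold A \<phi> \<xi> \<eta> g \<longleftrightarrow>
     smooth_atlas A \<and> connected (UNIV :: 'a set) \<and>
     almost_paracontact A \<phi> \<xi> \<eta> \<and> pseudo_riemannian_metric A g \<and>
     (\<forall>p. \<forall>v\<in>tangent_space A p. \<forall>w\<in>tangent_space A p.
        g p (\<phi> p v) (\<phi> p w) = - g p v w + \<eta> p v * \<eta> p w) \<and>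
     (\<forall>U X Y. open U \<and> smooth_vfield A U X \<and> smooth_vfield A U Y \<longrightarrow>
        (\<forall>p\<in>U. ext_d A \<eta> X Y p = g p (X p) (\<phi> p (Y p))))"

definition phi_basis ::
    "('a::{t2_space,second_countable_topology}) chart set \<Rightarrow> ('a \<Rightarrow> 'a tvec \<Rightarrow> 'a tvec) \<Rightarrow>
     'a vfield \<Rightarrow> ('a \<Rightarrow> 'a tvec \<Rightarrow> 'a tvec \<Rightarrow> real) \<Rightarrow> 'a set \<Rightarrow> 'a vfield \<Rightarrow> bool" where
  "phi_basis A \<phi> \<xi> g U e \<longleftrightarrow>
     open U \<and> smooth_vfield A U e \<and>
     (\<forall>p\<in>U. g p (\<xi> p) (\<xi> p) = 1 \<and> g p (e p) (e p) = 1 \<and> g p (\<phi> p (e p)) (\<phi> p (e p)) = -1 \<and>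
        g p (\<xi> p) (e p) = 0 \<and> g p (\<xi> p) (\<phi> p (e p)) = 0 \<and> g p (e p) (\<phi> p (e p)) = 0)"

text \<open>
  A choice of sign on \<open>U\<close>, locally constant on a dense open subset of \<open>U\<close>.  It cannot be required
  to be constant: with \<open>E\<^sub>\<plusminus> = e \<plusminus> \<phi> e\<close>, one has \<open>h E\<^sub>+ = u E\<^sub>-\<close> and \<open>h E\<^sub>- = v E\<^sub>+\<close> for
  \<open>h = (1/2) L\<^sub>\<xi> \<phi>\<close>, harmonicity gives \<open>u v = 0\<close>, and the sign tells which factor vanishes.  The
  open sets where \<open>u \<noteq> 0\<close> and \<open>v \<noteq> 0\<close> can both accumulate at a point, and then no neighbourhood
  of that point admits a constant sign.
\<close>

definition local_sign :: "('a::topological_space) set \<Rightarrow> ('a \<Rightarrow> real) \<Rightarrow> bool" where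
  "local_sign U \<epsilon> \<longleftrightarrow>
     (\<forall>p\<in>U. \<epsilon> p \<in> {1, -1}) \<and>
     (\<exists>W. open W \<and> W \<subseteq> U \<and> U \<subseteq> closure W \<and>
        (\<forall>p\<in>W. \<exists>N. open N \<and> p \<in> N \<and> N \<subseteq> W \<and> (\<forall>q\<in>N. \<epsilon> q = \<epsilon> p)))"

end

theory Submission
  imports Defs
begin

text \<open>
  Let \<open>f = \<phi> e\<close> in a local \<open>\<phi>\<close>-basis and write \<open>[\<xi>, e] = \<alpha> e + \<beta> f\<close>, \<open>[\<xi>, f] = \<gamma> e + \<delta> f\<close>,
  \<open>[e, f] = - 2 \<xi> + a\<^sub>4 e - a\<^sub>5 f\<close>.  The Jacobi identity gives \<open>\<delta> = - \<alpha>\<close> and expresses \<open>\<xi> a\<^sub>4\<close> and \<open>\<xi> a\<^sub>5\<close>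
  by the other data.  Computing the Levi-Civita connection from Koszul's formula, one finds
  \<open>tr (L\<^sub>\<xi> \<nabla>) = ((\<gamma> - \<beta>)\<^sup>2 - 4 \<alpha>\<^sup>2) \<xi> + 2 P e + 2 Q f\<close> with \<open>P\<close> and \<open>Q\<close> linear in the first derivatives
  of \<open>\<alpha>\<close>, \<open>\<beta>\<close>, \<open>\<gamma>\<close>.  Put \<open>a\<^sub>1 = (\<gamma> - \<beta>) / 2\<close> and \<open>a\<^sub>3 = (\<gamma> + \<beta>) / 2 - 1\<close>.  The \<open>\<xi>\<close>-component vanishes
  iff \<open>\<alpha> = - \<epsilon> a\<^sub>1\<close> for a sign \<open>\<epsilon>\<close>.  Where \<open>\<epsilon>\<close> is locally constant this relation can be differentiated,
  and \<open>P = 0\<close>, \<open>Q = 0\<close> and the three equations for \<open>a\<^sub>1, a\<^sub>3, a\<^sub>4, a\<^sub>5\<close> all reduce to the third of these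
  equations; the remaining points are reached by continuity.
\<close>

section \<open>Smooth functions on open subsets of three-space\<close>

text \<open>Two obstacles shape the proof. Harmonicity speaks of all pseudo-orthonormal frames,
  while the computation lives in a \<phi>-basis. Hence the Lie derivative of \<nabla> must first be
  shown function-linear in both arguments, for a connection that is only an abstract operator and
  whose locality has to be derived from its axioms. That a \<phi>-basis spans is obtained from the
  two eigenlines of \<phi> on the kernel of \<eta>; a null vector in one of them also leads to the
  space-like vector from which a basis is built. The contact condition then fixes the
  \<xi>-components of the frame brackets, which leaves the six structure functions.

  The second obstacle is the sign. The \<xi>-coefficient of the trace is 4 times the product of
  \<open>a\<^sub>1 + \<alpha>\<close> and \<open>a\<^sub>1 - \<alpha>\<close>. That a factor
  vanishes at a point says nothing about its derivatives there, but \<open>P\<close> and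
  \<open>Q\<close> contain derivatives of \<alpha>. The sign must therefore be chosen so that the
  relation can be differentiated even at points where the sign jumps.\<close>

lemma frechet_derivative_cong_open:
  assumes "open S" "x \<in> S" "\<And>y. y \<in> S \<Longrightarrow> f y = g y"
  shows "frechet_derivative f (at x) = frechet_derivative g (at x)"
    and "f differentiable (at x) \<longleftrightarrow> g differentiable (at x)"
proof -
  have *: "(f has_derivative D) (at x) \<longleftrightarrow> (g has_derivative D) (at x)" for D
    using has_derivative_transform_within_open[OF _ assms(1,2), of f D UNIV g]
      has_derivative_transform_within_open[OF _ assms(1,2), of g D UNIV f] assms(3) by auto
  then show "frechet_derivative f (at x) = frechet_derivative g (at x)"
    by (simp add: frechet_derivative_def)
  show "f differentiable (at x) \<longleftrightarrow> g differentiable (at x)"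
    using * by (simp add: differentiable_def)
qed

lemma Ck_on_subset: "Ck_on k S f \<Longrightarrow> T \<subseteq> S \<Longrightarrow> Ck_on k T f"
  by (induction k arbitrary: f) (auto intro: continuous_on_subset)

lemma Ck_on_cong:
  assumes "open S" "\<And>x. x \<in> S \<Longrightarrow> f x = g x" "Ck_on k S f"
  shows "Ck_on k S g"
  using assms(2,3)
proof (induction k arbitrary: f g)
  case 0
  then show ?case by (simp cong: continuous_on_cong)
next
  case (Suc k)
  show ?case
    using Suc.prems frechet_derivative_cong_open[OF assms(1) _ Suc.prems(1)]
    by (auto intro!: Suc.IH[of "\<lambda>x. frechet_derivative f (at x) v"
        "\<lambda>x. frechet_derivative g (at x) v" for v])
qed

text \<open>The derivative of a product or a composite contains undifferentiated factors again, and
  the induction hypothesis wants these one order lower.\<close>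

lemma Ck_on_SucD: "Ck_on (Suc k) S f \<Longrightarrow> Ck_on k S f"
proof (induction k arbitrary: f)
  case 0
  then show ?case
    by (auto intro!: continuous_at_imp_continuous_on differentiable_imp_continuous_within)
next
  case (Suc k)
  then show ?case by (metis Ck_on.simps(2))
qed

text \<open>The closure properties below go by induction on \<open>k\<close> with this rule: the
  induction hypothesis applies to an explicit formula \<open>D\<close>, but not to
  \<open>frechet_derivative\<close> of a compound function.\<close>

lemma Ck_on_SucI:
  assumes "open S" "\<And>x. x \<in> S \<Longrightarrow> (f has_derivative D x) (at x)"
    "\<And>v. Ck_on k S (\<lambda>x. D x v)"
  shows "Ck_on (Suc k) S f"
proof -
  have "frechet_derivative f (at x) = D x" if "x \<in> S" for x
    using frechet_derivative_at[OF assms(2)[OF that]] by simp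
  then have "Ck_on k S (\<lambda>x. frechet_derivative f (at x) v)" for v
    using Ck_on_cong[OF assms(1) _ assms(3)[of v]] by simp
  then show ?thesis using assms(2) by (auto simp: differentiable_def)
qed

lemma Ck_on_has_derivative:
  "Ck_on (Suc k) S f \<Longrightarrow> x \<in> S \<Longrightarrow> (f has_derivative frechet_derivative f (at x)) (at x)"
  by (simp add: frechet_derivative_works)

lemma Ck_on_const: "open S \<Longrightarrow> Ck_on k S (\<lambda>x. c)"
proof (induction k arbitrary: c)
  case (Suc k)
  show ?case by (rule Ck_on_SucI[OF Suc.prems has_derivative_const]) (rule Suc.IH[OF Suc.prems])
qed simp

lemma Ck_on_add:
  "open S \<Longrightarrow> Ck_on k S f \<Longrightarrow> Ck_on k S g \<Longrightarrow> Ck_on k S (\<lambda>x. f x + g x)"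
proof (induction k arbitrary: f g)
  case 0
  then show ?case by (simp add: continuous_on_add)
next
  case (Suc k)
  show ?case
    by (rule Ck_on_SucI[OF Suc.prems(1)
          has_derivative_add[OF Ck_on_has_derivative[OF Suc.prems(2)] Ck_on_has_derivative[OF Suc.prems(3)]]])
      (use Suc in auto)
qed

lemma Ck_on_bounded_linear:
  assumes "bounded_linear L"
  shows "open S \<Longrightarrow> Ck_on k S f \<Longrightarrow> Ck_on k S (\<lambda>x. L (f x))"
proof (induction k arbitrary: f)
  case 0
  then show ?case by (simp add: bounded_linear.continuous_on[OF assms])
next
  case (Suc k)
  show ?case
    by (rule Ck_on_SucI[OF Suc.prems(1)
          bounded_linear.has_derivative[OF assms Ck_on_has_derivative[OF Suc.prems(2)]]])
      (use Suc in auto)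
qed

lemma Ck_on_mult:
  fixes f g :: "real^3 \<Rightarrow> real"
  shows "open S \<Longrightarrow> Ck_on k S f \<Longrightarrow> Ck_on k S g \<Longrightarrow> Ck_on k S (\<lambda>x. f x * g x)"
proof (induction k arbitrary: f g)
  case 0
  then show ?case by (simp add: continuous_on_mult)
next
  case (Suc k)
  show ?case
    by (rule Ck_on_SucI[OF Suc.prems(1)
          has_derivative_mult[OF Ck_on_has_derivative[OF Suc.prems(2)] Ck_on_has_derivative[OF Suc.prems(3)]]])
      (use Suc in \<open>auto intro!: Ck_on_add Suc.IH dest: Ck_on_SucD simp del: Ck_on.simps(2)\<close>,
       use Suc.prems in auto)
qed

text \<open>The exponent varies in the induction because differentiation lowers it by one. With
  exponent -1/2 this will normalise a vector field of positive square.\<close>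

lemma Ck_on_powr:
  fixes f :: "real^3 \<Rightarrow> real"
  assumes "open S" "\<And>x. x \<in> S \<Longrightarrow> f x > 0"
  shows "Ck_on k S f \<Longrightarrow> Ck_on k S (\<lambda>x. f x powr a)"
proof (induction k arbitrary: a)
  case 0
  then show ?case using assms by (fastforce intro!: continuous_on_powr)
next
  case (Suc k)
  have "Ck_on k S (\<lambda>x. frechet_derivative f (at x) v * (a * f x powr (a - 1)))" for v
    using Suc Ck_on_SucD[OF Suc.prems] assms(1) by (auto intro!: Ck_on_mult Ck_on_const)
  then show ?case
    by (rule Ck_on_SucI[OF assms(1) DERIV_compose_FDERIV[OF has_real_derivative_powr[OF assms(2)]
            Ck_on_has_derivative[OF Suc.prems]], rotated 2])
qed

lemma Ck_on_compose:
  fixes f :: "real^3 \<Rightarrow> real" and h :: "real^3 \<Rightarrow> real^3"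
  assumes "open S" "h ` S \<subseteq> T"
  shows "Ck_on k T f \<Longrightarrow> Ck_on k S h \<Longrightarrow> Ck_on k S (\<lambda>x. f (h x))"
proof (induction k arbitrary: f)
  case 0
  then show ?case using assms(2) continuous_on_compose2 by fastforce
next
  case (Suc k)
  \<comment> \<open>\<open>Ck_on\<close> controls the derivative of \<open>f\<close> in fixed
    directions only, whereas the chain rule evaluates it in a direction that moves with
    \<open>x\<close>. Expanding along the axes separates the two.\<close>
  let ?D = "\<lambda>x v. \<Sum>i\<in>UNIV. (frechet_derivative h (at x) v $ i) *
    frechet_derivative f (at (h x)) (axis i 1)"
  have D: "(\<lambda>v. frechet_derivative f (at (h x)) (frechet_derivative h (at x) v)) = ?D x"
    if "x \<in> S" for x
  proof
    fix v
    have "linear (frechet_derivative f (at (h x)))"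
      using Suc.prems(1) that assms(2) linear_frechet_derivative by auto
    then have *: "frechet_derivative f (at (h x)) (\<Sum>i\<in>UNIV. w $ i *\<^sub>R axis i 1) =
        (\<Sum>i\<in>UNIV. w $ i * frechet_derivative f (at (h x)) (axis i 1))" for w
      by (simp add: linear_sum linear_cmul)
    have "(\<Sum>i\<in>UNIV. w $ i *\<^sub>R axis i 1) = w" for w :: "real^3"
      using basis_expansion[of w] by (simp only: scalar_mult_eq_scaleR)
    with *[of "frechet_derivative h (at x) v"]
    show "frechet_derivative f (at (h x)) (frechet_derivative h (at x) v) = ?D x v"
      by (simp only:)
  qed
  have H: "((\<lambda>x. f (h x)) has_derivative
      (\<lambda>v. frechet_derivative f (at (h x)) (frechet_derivative h (at x) v))) (at x)"
    if "x \<in> S" for x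
    by (rule has_derivative_compose[OF Ck_on_has_derivative[OF Suc.prems(2) that]
          Ck_on_has_derivative[OF Suc.prems(1)]]) (use that assms(2) in auto)
  have "((\<lambda>x. f (h x)) has_derivative ?D x) (at x)" if "x \<in> S" for x
    by (rule H[OF that, unfolded D[OF that]])
  moreover have "Ck_on k S (\<lambda>x. frechet_derivative h (at x) v $ i)" for v i
    by (rule Ck_on_bounded_linear[OF bounded_linear_vec_nth assms(1)]) (use Suc.prems(2) in auto)
  moreover have "Ck_on k S (\<lambda>x. frechet_derivative f (at (h x)) w)" for w
    by (rule Suc.IH) (use Suc.prems Ck_on_SucD[OF Suc.prems(2)] in auto)
  ultimately show ?case
    by (intro Ck_on_SucI[OF assms(1), where D = ?D])
      (auto simp: sum_3 intro!: Ck_on_add Ck_on_mult assms(1))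
qed

lemma smooth_on_cong:
  "open S \<Longrightarrow> (\<And>x. x \<in> S \<Longrightarrow> f x = g x) \<Longrightarrow> smooth_on S f \<Longrightarrow> smooth_on S g"
  unfolding smooth_on_def using Ck_on_cong by metis

lemma smooth_on_subset: "smooth_on S f \<Longrightarrow> T \<subseteq> S \<Longrightarrow> smooth_on T f"
  unfolding smooth_on_def using Ck_on_subset by metis

lemma smooth_on_differentiable: "smooth_on S f \<Longrightarrow> x \<in> S \<Longrightarrow> f differentiable (at x)"
  unfolding smooth_on_def by (metis Ck_on.simps(2))

lemma smooth_on_frechet_derivative:
  "smooth_on S f \<Longrightarrow> smooth_on S (\<lambda>x. frechet_derivative f (at x) v)"
  unfolding smooth_on_def by (metis Ck_on.simps(2))

lemma smooth_on_const: "open S \<Longrightarrow> smooth_on S (\<lambda>x. c)"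
  by (simp add: smooth_on_def Ck_on_const)

lemma smooth_on_add:
  "open S \<Longrightarrow> smooth_on S f \<Longrightarrow> smooth_on S g \<Longrightarrow> smooth_on S (\<lambda>x. f x + g x)"
  by (simp add: smooth_on_def Ck_on_add)

lemma smooth_on_mult:
  fixes f g :: "real^3 \<Rightarrow> real"
  shows "open S \<Longrightarrow> smooth_on S f \<Longrightarrow> smooth_on S g \<Longrightarrow> smooth_on S (\<lambda>x. f x * g x)"
  by (simp add: smooth_on_def Ck_on_mult)

lemma smooth_on_powr:
  fixes f :: "real^3 \<Rightarrow> real"
  shows "open S \<Longrightarrow> (\<And>x. x \<in> S \<Longrightarrow> f x > 0) \<Longrightarrow> smooth_on S f \<Longrightarrow> smooth_on S (\<lambda>x. f x powr a)"
  by (simp add: smooth_on_def Ck_on_powr)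

lemma smooth_on_compose:
  fixes f :: "real^3 \<Rightarrow> real" and h :: "real^3 \<Rightarrow> real^3"
  shows "open S \<Longrightarrow> h ` S \<subseteq> T \<Longrightarrow> smooth_on T f \<Longrightarrow> smooth_on S h \<Longrightarrow> smooth_on S (\<lambda>x. f (h x))"
  unfolding smooth_on_def using Ck_on_compose by metis

section \<open>Tangent vectors and smooth vector fields\<close>

locale smooth_manifold =
  fixes A :: "('a::{t2_space,second_countable_topology}) chart set"
  assumes atlas: "smooth_atlas A"
begin

lemma chart_ex: "\<exists>U \<kappa>. (U, \<kappa>) \<in> A \<and> p \<in> U"
  using atlas unfolding smooth_atlas_def by (metis (no_types, lifting) UN_E UNIV_I case_prod_beta prod.collapse)

lemma chart_open: "(U, \<kappa>) \<in> A \<Longrightarrow> open U"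
  using atlas unfolding smooth_atlas_def by blast

lemma chart_homeomorphism: "(U, \<kappa>) \<in> A \<Longrightarrow> homeomorphism U (\<kappa> ` U) \<kappa> (inv_into U \<kappa>)"
  using atlas unfolding smooth_atlas_def by blast

lemma chart_inv: "(U, \<kappa>) \<in> A \<Longrightarrow> q \<in> U \<Longrightarrow> inv_into U \<kappa> (\<kappa> q) = q"
  using chart_homeomorphism homeomorphism_apply1 by blast

lemma chart_image_open:
  assumes "(U, \<kappa>) \<in> A" "open W"
  shows "open (\<kappa> ` (U \<inter> W))"
proof -
  have "openin (top_of_set (\<kappa> ` U)) (\<kappa> ` (U \<inter> W))"
    using homeomorphism_imp_open_map[OF chart_homeomorphism[OF assms(1)]] assms(2)
    by (simp add: openin_open_Int)
  moreover have "open (\<kappa> ` U)"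
    using atlas assms(1) unfolding smooth_atlas_def by blast
  ultimately show ?thesis using openin_open_trans by blast
qed

lemma transition_smooth:
  "(U, \<kappa>) \<in> A \<Longrightarrow> (V, \<mu>) \<in> A \<Longrightarrow> smooth_on (\<kappa> ` (U \<inter> V)) (\<mu> \<circ> inv_into U \<kappa>)"
  using atlas unfolding smooth_atlas_def by blast

section \<open>Smooth real functions on the manifold\<close>

lemma smooth_funI:
  "(\<And>U \<kappa>. (U, \<kappa>) \<in> A \<Longrightarrow> smooth_on (\<kappa> ` (U \<inter> W)) (\<lambda>x. f (inv_into U \<kappa> x))) \<Longrightarrow> smooth_fun A W f"
  unfolding smooth_fun_def by (auto simp: o_def)

lemma smooth_funD:
  "smooth_fun A W f \<Longrightarrow> (U, \<kappa>) \<in> A \<Longrightarrow> smooth_on (\<kappa> ` (U \<inter> W)) (\<lambda>x. f (inv_into U \<kappa> x))"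
  unfolding smooth_fun_def by (auto simp: o_def)

lemma smooth_fun_subset: "smooth_fun A W f \<Longrightarrow> V \<subseteq> W \<Longrightarrow> smooth_fun A V f"
  by (rule smooth_funI, rule smooth_on_subset[OF smooth_funD]) auto

lemma smooth_fun_cong:
  assumes "open W" "\<And>q. q \<in> W \<Longrightarrow> f q = g q" "smooth_fun A W f"
  shows "smooth_fun A W g"
  by (rule smooth_funI, rule smooth_on_cong[OF _ _ smooth_funD[OF assms(3)]])
    (auto simp: chart_image_open assms chart_inv)

lemma smooth_fun_const: "open W \<Longrightarrow> smooth_fun A W (\<lambda>q. c)"
  by (rule smooth_funI) (auto intro: smooth_on_const chart_image_open)

lemma smooth_fun_add:
  "open W \<Longrightarrow> smooth_fun A W f \<Longrightarrow> smooth_fun A W g \<Longrightarrow> smooth_fun A W (\<lambda>q. f q + g q)"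
  by (rule smooth_funI) (auto intro: smooth_on_add chart_image_open smooth_funD)

lemma smooth_fun_mult:
  "open W \<Longrightarrow> smooth_fun A W f \<Longrightarrow> smooth_fun A W g \<Longrightarrow> smooth_fun A W (\<lambda>q. f q * g q)"
  by (rule smooth_funI) (auto intro: smooth_on_mult chart_image_open smooth_funD)

lemma smooth_fun_powr:
  "open W \<Longrightarrow> (\<And>q. q \<in> W \<Longrightarrow> f q > 0) \<Longrightarrow> smooth_fun A W f \<Longrightarrow> smooth_fun A W (\<lambda>q. f q powr a)"
  by (rule smooth_funI, rule smooth_on_powr) (auto intro: chart_image_open smooth_funD simp: chart_inv)

lemma smooth_fun_uminus: "open W \<Longrightarrow> smooth_fun A W f \<Longrightarrow> smooth_fun A W (\<lambda>q. - f q)"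
  using smooth_fun_mult[of W "\<lambda>q. - 1" f] by (simp add: smooth_fun_const)

lemma smooth_fun_diff:
  "open W \<Longrightarrow> smooth_fun A W f \<Longrightarrow> smooth_fun A W g \<Longrightarrow> smooth_fun A W (\<lambda>q. f q - g q)"
  using smooth_fun_add[of W f "\<lambda>q. - g q"] by (simp add: smooth_fun_uminus)

lemmas smooth_fun_intros =
  smooth_fun_const smooth_fun_add smooth_fun_mult smooth_fun_uminus smooth_fun_diff

lemma smooth_fun_continuous_on:
  assumes "open W" "smooth_fun A W f"
  shows "continuous_on W f"
  unfolding continuous_on_eq_continuous_at[OF assms(1)]
proof
  fix p assume "p \<in> W"
  obtain U \<kappa> where U: "(U, \<kappa>) \<in> A" "p \<in> U" using chart_ex by blast
  have "continuous_on (\<kappa> ` (U \<inter> W)) (\<lambda>x. f (inv_into U \<kappa> x))"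
    using smooth_funD[OF assms(2) U(1)] unfolding smooth_on_def by (metis Ck_on.simps(1))
  moreover have "continuous_on (U \<inter> W) \<kappa>"
    using homeomorphism_cont1[OF chart_homeomorphism[OF U(1)]] continuous_on_subset by blast
  ultimately have "continuous_on (U \<inter> W) (\<lambda>q. f (inv_into U \<kappa> (\<kappa> q)))"
    by (rule continuous_on_compose2) auto
  then have "continuous_on (U \<inter> W) f"
    by (rule continuous_on_eq) (simp add: chart_inv[OF U(1)])
  then show "isCont f p"
    using continuous_on_eq_continuous_at[of "U \<inter> W" f] chart_open[OF U(1)] assms(1) U(2) \<open>p \<in> W\<close>
    by blast
qed

lemma smooth_atI: "open W \<Longrightarrow> p \<in> W \<Longrightarrow> smooth_fun A W f \<Longrightarrow> smooth_at A p f"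
  unfolding smooth_at_def by blast

lemma smooth_at_cong:
  assumes "open W" "p \<in> W" "\<And>q. q \<in> W \<Longrightarrow> f q = g q"
  shows "smooth_at A p f \<longleftrightarrow> smooth_at A p g"
proof -
  have "smooth_at A p k" if h: "smooth_at A p h" and hk: "\<And>q. q \<in> W \<Longrightarrow> h q = k q" for h k
  proof -
    obtain V where V: "open V" "p \<in> V" "smooth_fun A V h" using h unfolding smooth_at_def by blast
    have "smooth_fun A (V \<inter> W) k"
      by (rule smooth_fun_cong[OF _ _ smooth_fun_subset[OF V(3)]]) (use V(1) assms(1) hk in auto)
    then show ?thesis using V assms(1,2) by (meson IntI open_Int smooth_atI)
  qed
  then show ?thesis using assms(3) by metis
qed

lemma smooth_at_differentiable:
  assumes "(U, \<kappa>) \<in> A" "p \<in> U" "smooth_at A p f"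
  shows "(\<lambda>x. f (inv_into U \<kappa> x)) differentiable (at (\<kappa> p))"
proof -
  obtain W where "open W" "p \<in> W" "smooth_fun A W f" using assms(3) unfolding smooth_at_def by blast
  then show ?thesis
    using smooth_on_differentiable[OF smooth_funD[OF _ assms(1)]] assms(2) by blast
qed

section \<open>Tangent vectors as directional derivatives\<close>

lemma dir_deriv_eq:
  "dir_deriv A (U, \<kappa>) p w f = (if smooth_at A p f
     then frechet_derivative (\<lambda>x. f (inv_into U \<kappa> x)) (at (\<kappa> p)) w else 0)"
  by (simp add: dir_deriv_def o_def)

text \<open>This is the chain rule for the transition map. The cutoff by \<open>smooth_at\<close>
  does not refer to a chart, so both sides are set to 0 on the same functions.\<close>

lemma dir_deriv_change_chart:
  assumes U: "(U, \<kappa>) \<in> A" "p \<in> U" and V: "(V, \<mu>) \<in> A" "p \<in> V"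
  shows "dir_deriv A (U, \<kappa>) p w =
    dir_deriv A (V, \<mu>) p (frechet_derivative (\<mu> \<circ> inv_into U \<kappa>) (at (\<kappa> p)) w)"
proof
  fix f :: "'a \<Rightarrow> real"
  let ?F = "\<lambda>x. f (inv_into V \<mu> x)" and ?t = "\<mu> \<circ> inv_into U \<kappa>"
  have "frechet_derivative (\<lambda>x. f (inv_into U \<kappa> x)) (at (\<kappa> p)) w =
      frechet_derivative ?F (at (\<mu> p)) (frechet_derivative ?t (at (\<kappa> p)) w)"
    if f: "smooth_at A p f"
  proof -
    have "frechet_derivative (\<lambda>x. f (inv_into U \<kappa> x)) (at (\<kappa> p)) =
        frechet_derivative (?F \<circ> ?t) (at (\<kappa> p))"
      by (rule frechet_derivative_cong_open[OF chart_image_open[OF U(1) chart_open[OF V(1)]]])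
        (use U V in \<open>auto simp: chart_inv\<close>)
    also have "\<dots> = frechet_derivative ?F (at (?t (\<kappa> p))) \<circ> frechet_derivative ?t (at (\<kappa> p))"
      by (rule frechet_derivative_compose)
        (use U V f in \<open>auto simp: chart_inv intro!: smooth_at_differentiable
            smooth_on_differentiable[OF transition_smooth[OF U(1) V(1)]]\<close>)
    finally show ?thesis by (simp add: chart_inv[OF U])
  qed
  then show "dir_deriv A (U, \<kappa>) p w f = dir_deriv A (V, \<mu>) p (frechet_derivative ?t (at (\<kappa> p)) w) f"
    by (simp add: dir_deriv_eq)
qed

lemma tangent_space_chart:
  assumes "(V, \<mu>) \<in> A" "p \<in> V"
  shows "tangent_space A p = range (dir_deriv A (V, \<mu>) p)"
proof
  show "tangent_space A p \<subseteq> range (dir_deriv A (V, \<mu>) p)"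
    unfolding tangent_space_def
    by (auto simp: dir_deriv_change_chart[OF _ _ assms])
  show "range (dir_deriv A (V, \<mu>) p) \<subseteq> tangent_space A p"
    unfolding tangent_space_def using assms by force
qed

lemma linear_dir_deriv:
  assumes "(V, \<mu>) \<in> A" "p \<in> V"
  shows "linear (dir_deriv A (V, \<mu>) p)"
proof -
  have "dir_deriv A (V, \<mu>) p (x + y) f = dir_deriv A (V, \<mu>) p x f + dir_deriv A (V, \<mu>) p y f \<and>
    dir_deriv A (V, \<mu>) p (c *\<^sub>R x) f = c * dir_deriv A (V, \<mu>) p x f" for x y c f
    using linear_frechet_derivative[OF smooth_at_differentiable[OF assms]]
    by (auto simp: dir_deriv_eq linear_add linear_cmul)
  then show ?thesis by (intro linearI ext) (auto simp: scaleR_fun_def)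
qed

lemma subspace_tangent_space: "subspace (tangent_space A p)"
proof -
  obtain U \<kappa> where U: "(U, \<kappa>) \<in> A" "p \<in> U" using chart_ex by blast
  show ?thesis
    unfolding tangent_space_chart[OF U] using linear_subspace_image[OF linear_dir_deriv[OF U]] by simp
qed

lemmas tangent_add = subspace_add[OF subspace_tangent_space]
lemmas tangent_scaleR = subspace_scale[OF subspace_tangent_space]
lemmas tangent_diff = subspace_diff[OF subspace_tangent_space]
lemmas tangent_neg = subspace_neg[OF subspace_tangent_space]
lemmas tangent_0 = subspace_0[OF subspace_tangent_space]

lemma tangent_nonsmooth: "v \<in> tangent_space A p \<Longrightarrow> \<not> smooth_at A p f \<Longrightarrow> v f = 0"
  unfolding tangent_space_def by (auto simp: dir_deriv_eq)

text \<open>The cutoff by \<open>smooth_at\<close> depends only on the germ, just as the derivative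
  does. This is what allows an identity that holds on an open set to be differentiated
  there.\<close>

lemma tangent_cong:
  assumes "v \<in> tangent_space A p" "open W" "p \<in> W" "\<And>q. q \<in> W \<Longrightarrow> f q = g q"
  shows "v f = v g"
proof -
  obtain U \<kappa> where U: "(U, \<kappa>) \<in> A" "p \<in> U" using chart_ex by blast
  obtain w where v: "v = dir_deriv A (U, \<kappa>) p w" using assms(1) tangent_space_chart[OF U] by auto
  have "frechet_derivative (\<lambda>x. f (inv_into U \<kappa> x)) (at (\<kappa> p)) =
      frechet_derivative (\<lambda>x. g (inv_into U \<kappa> x)) (at (\<kappa> p))"
    by (rule frechet_derivative_cong_open[OF chart_image_open[OF U(1) assms(2)]])
      (use U assms in \<open>auto simp: chart_inv\<close>)
  then show ?thesis
    using smooth_at_cong[OF assms(2-4)] by (simp add: v dir_deriv_eq)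
qed

lemma tangent_const:
  assumes "v \<in> tangent_space A p"
  shows "v (\<lambda>q. c) = 0"
proof -
  obtain U \<kappa> w where "v = dir_deriv A (U, \<kappa>) p w"
    using assms unfolding tangent_space_def by auto
  then show ?thesis by (simp add: dir_deriv_eq)
qed

text \<open>Smoothness of both functions near \<open>p\<close> matters: the cutoff sends two
  functions that are not smooth to 0, though their sum may be smooth with nonzero
  derivative.\<close>

lemma
  assumes v: "v \<in> tangent_space A p" and W: "open W" "p \<in> W"
    and f: "smooth_fun A W f" and g: "smooth_fun A W g"
  shows tangent_fun_add: "v (\<lambda>q. f q + g q) = v f + v g"
    and tangent_fun_mult: "v (\<lambda>q. f q * g q) = f p * v g + g p * v f"
proof -
  obtain U \<kappa> where U: "(U, \<kappa>) \<in> A" "p \<in> U" using chart_ex by blast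
  obtain w where w: "v = dir_deriv A (U, \<kappa>) p w" using v tangent_space_chart[OF U] by auto
  have s: "smooth_at A p f" "smooth_at A p g"
    "smooth_at A p (\<lambda>q. f q + g q)" "smooth_at A p (\<lambda>q. f q * g q)"
    using W f g by (auto intro!: smooth_atI[of W] smooth_fun_intros)
  have D: "((\<lambda>x. h (inv_into U \<kappa> x)) has_derivative (\<lambda>w. dir_deriv A (U, \<kappa>) p w h)) (at (\<kappa> p))"
    if "smooth_at A p h" for h
    using smooth_at_differentiable[OF U that] that
    by (simp add: dir_deriv_eq frechet_derivative_works)
  show "v (\<lambda>q. f q + g q) = v f + v g"
    using fun_cong[OF has_derivative_unique[OF D[OF s(3)] has_derivative_add[OF D[OF s(1)] D[OF s(2)]]]]
    by (simp add: w)
  show "v (\<lambda>q. f q * g q) = f p * v g + g p * v f"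
    using fun_cong[OF has_derivative_unique[OF D[OF s(4)] has_derivative_mult[OF D[OF s(1)] D[OF s(2)]]]]
    by (simp add: w chart_inv[OF U])
qed

lemma tangent_fun_diff:
  assumes v: "v \<in> tangent_space A p" and W: "open W" "p \<in> W"
    and f: "smooth_fun A W f" and g: "smooth_fun A W g"
  shows "v (\<lambda>q. f q - g q) = v f - v g"
  using tangent_fun_add[OF v W f smooth_fun_mult[OF W(1) smooth_fun_const[OF W(1), of "-1"] g]]
    tangent_fun_mult[OF v W smooth_fun_const[OF W(1), of "-1"] g]
  by (simp add: tangent_const[OF v])

section \<open>Smooth vector fields\<close>

lemma vfield_tangent: "smooth_vfield A U X \<Longrightarrow> p \<in> U \<Longrightarrow> X p \<in> tangent_space A p"
  by (simp add: smooth_vfield_def)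

lemma vfield_fun:
  "smooth_vfield A U X \<Longrightarrow> open W \<Longrightarrow> W \<subseteq> U \<Longrightarrow> smooth_fun A W f \<Longrightarrow> smooth_fun A W (\<lambda>p. X p f)"
  by (simp add: smooth_vfield_def)

lemma smooth_vfield_subset: "smooth_vfield A U X \<Longrightarrow> V \<subseteq> U \<Longrightarrow> smooth_vfield A V X"
  unfolding smooth_vfield_def by (meson subset_eq subset_trans)

lemma smooth_vfield_cong:
  assumes "\<And>q. q \<in> U \<Longrightarrow> X q = Y q" "smooth_vfield A U X"
  shows "smooth_vfield A U Y"
  unfolding smooth_vfield_def
proof (intro conjI ballI allI impI)
  show "Y p \<in> tangent_space A p" if "p \<in> U" for p
    using vfield_tangent[OF assms(2) that] assms(1)[OF that] by simp
  show "smooth_fun A W (\<lambda>p. Y p f)" if "open W \<and> W \<subseteq> U \<and> smooth_fun A W f" for W f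
    by (rule smooth_fun_cong[OF _ _ vfield_fun[OF assms(2)]]) (use that assms(1) in auto)
qed

lemma smooth_vfield_add:
  "smooth_vfield A U X \<Longrightarrow> smooth_vfield A U Y \<Longrightarrow> smooth_vfield A U (\<lambda>q. X q + Y q)"
  by (simp add: smooth_vfield_def tangent_add smooth_fun_add)

lemma smooth_vfield_scaleR:
  assumes "smooth_fun A U f" "smooth_vfield A U X"
  shows "smooth_vfield A U (\<lambda>q. f q *\<^sub>R X q)"
  unfolding smooth_vfield_def
proof (intro conjI ballI allI impI)
  show "f p *\<^sub>R X p \<in> tangent_space A p" if "p \<in> U" for p
    using vfield_tangent[OF assms(2) that] tangent_scaleR by blast
  show "smooth_fun A W (\<lambda>p. (f p *\<^sub>R X p) h)" if "open W \<and> W \<subseteq> U \<and> smooth_fun A W h" for W h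
    using that smooth_fun_mult[OF _ smooth_fun_subset[OF assms(1)] vfield_fun[OF assms(2)]]
    by (simp add: scaleR_fun_def)
qed

lemma smooth_vfield_zero: "smooth_vfield A U (\<lambda>q. 0)"
  by (auto simp: smooth_vfield_def tangent_0 intro: smooth_fun_const)

text \<open>Constant coefficients serve to extend a single tangent vector to a local field.
  Smoothness in another chart follows by composition with the transition map.\<close>

lemma smooth_vfield_coordinate:
  assumes U: "(U, \<kappa>) \<in> A"
  shows "smooth_vfield A U (\<lambda>q. dir_deriv A (U, \<kappa>) q w)"
  unfolding smooth_vfield_def
proof (intro conjI ballI allI impI)
  show "dir_deriv A (U, \<kappa>) q w \<in> tangent_space A q" if "q \<in> U" for q
    using tangent_space_chart[OF U that] by auto
  fix W f assume *: "open W \<and> W \<subseteq> U \<and> smooth_fun A W f"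
  let ?h = "\<lambda>x. frechet_derivative (\<lambda>x. f (inv_into U \<kappa> x)) (at x) w"
  show "smooth_fun A W (\<lambda>p. dir_deriv A (U, \<kappa>) p w f)"
  proof (rule smooth_fun_cong)
    show "open W" using * by simp
    show "?h (\<kappa> q) = dir_deriv A (U, \<kappa>) q w f" if "q \<in> W" for q
      using smooth_atI[of W q f] * that by (simp add: dir_deriv_eq)
    show "smooth_fun A W (\<lambda>q. ?h (\<kappa> q))"
    proof (rule smooth_funI)
      fix V \<mu> assume V: "(V, \<mu>) \<in> A"
      have "smooth_on (\<mu> ` (V \<inter> W)) (\<lambda>x. ?h ((\<kappa> \<circ> inv_into V \<mu>) x))"
      proof (rule smooth_on_compose)
        show "open (\<mu> ` (V \<inter> W))" using chart_image_open[OF V] * by simp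
        show "(\<kappa> \<circ> inv_into V \<mu>) ` (\<mu> ` (V \<inter> W)) \<subseteq> \<kappa> ` (U \<inter> W)"
          using * by (auto simp: chart_inv[OF V])
        show "smooth_on (\<kappa> ` (U \<inter> W)) ?h"
          using smooth_on_frechet_derivative[OF smooth_funD[OF _ U]] * by simp
        show "smooth_on (\<mu> ` (V \<inter> W)) (\<kappa> \<circ> inv_into V \<mu>)"
          by (rule smooth_on_subset[OF transition_smooth[OF V U]]) (use * in auto)
      qed
      then show "smooth_on (\<mu> ` (V \<inter> W)) (\<lambda>x. ?h (\<kappa> (inv_into V \<mu> x)))" by simp
    qed
  qed
qed

end

section \<open>Lie bracket and Levi-Civita connection\<close>

context smooth_manifold
begin

lemma smooth_atE:
  assumes "smooth_at A p f" "open U" "p \<in> U"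
  obtains W where "open W" "W \<subseteq> U" "p \<in> W" "smooth_fun A W f"
proof -
  obtain W where W: "open W" "p \<in> W" "smooth_fun A W f"
    using assms(1) unfolding smooth_at_def by blast
  then show ?thesis
    by (intro that[of "W \<inter> U"]) (use assms in \<open>auto intro: smooth_fun_subset\<close>)
qed

lemma lie_bracket_apply:
  "smooth_at A p f \<Longrightarrow> lie_bracket A X Y p f = X p (\<lambda>q. Y q f) - Y p (\<lambda>q. X q f)"
  by (simp add: lie_bracket_def)

lemma lie_bracket_nonsmooth: "\<not> smooth_at A p f \<Longrightarrow> lie_bracket A X Y p f = 0"
  by (simp add: lie_bracket_def)

lemma lie_bracket_antisym: "lie_bracket A X Y p = - lie_bracket A Y X p"
  by (rule ext) (simp add: lie_bracket_def)

lemma lie_bracket_cong: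
  assumes U: "open U" "p \<in> U" and eq: "\<And>q. q \<in> U \<Longrightarrow> X q = X' q" "\<And>q. q \<in> U \<Longrightarrow> Y q = Y' q"
    and X: "X p \<in> tangent_space A p" and Y: "Y p \<in> tangent_space A p"
  shows "lie_bracket A X Y p = lie_bracket A X' Y' p"
proof
  fix f
  have "X p (\<lambda>q. Y q f) = X p (\<lambda>q. Y' q f)" "Y p (\<lambda>q. X q f) = Y p (\<lambda>q. X' q f)"
    by (rule tangent_cong[OF X U], simp add: eq(2)) (rule tangent_cong[OF Y U], simp add: eq(1))
  then show "lie_bracket A X Y p f = lie_bracket A X' Y' p f"
    by (simp add: lie_bracket_def eq U)
qed

lemma lie_bracket_add_left:
  assumes U: "open U" "p \<in> U" and X: "smooth_vfield A U X" and Y: "smooth_vfield A U Y"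
    and Z: "smooth_vfield A U Z"
  shows "lie_bracket A (\<lambda>q. X q + Z q) Y p = lie_bracket A X Y p + lie_bracket A Z Y p"
proof
  fix f
  show "lie_bracket A (\<lambda>q. X q + Z q) Y p f = (lie_bracket A X Y p + lie_bracket A Z Y p) f"
  proof (cases "smooth_at A p f")
    case True
    then obtain W where W: "open W" "W \<subseteq> U" "p \<in> W" "smooth_fun A W f" using smooth_atE U by blast
    show ?thesis
      using tangent_fun_add[OF vfield_tangent[OF Y U(2)] W(1,3) vfield_fun[OF X W(1,2,4)]
          vfield_fun[OF Z W(1,2,4)]]
      by (simp add: lie_bracket_apply True)
  qed (simp add: lie_bracket_nonsmooth)
qed

lemma lie_bracket_scaleR_left:
  assumes U: "open U" "p \<in> U" and h: "smooth_fun A U h"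
    and X: "smooth_vfield A U X" and Y: "smooth_vfield A U Y"
  shows "lie_bracket A (\<lambda>q. h q *\<^sub>R X q) Y p = h p *\<^sub>R lie_bracket A X Y p - Y p h *\<^sub>R X p"
proof
  fix f
  show "lie_bracket A (\<lambda>q. h q *\<^sub>R X q) Y p f = (h p *\<^sub>R lie_bracket A X Y p - Y p h *\<^sub>R X p) f"
  proof (cases "smooth_at A p f")
    case True
    then obtain W where W: "open W" "W \<subseteq> U" "p \<in> W" "smooth_fun A W f" using smooth_atE U by blast
    show ?thesis
      using tangent_fun_mult[OF vfield_tangent[OF Y U(2)] W(1,3) smooth_fun_subset[OF h W(2)]
          vfield_fun[OF X W(1,2,4)]]
      by (simp add: lie_bracket_apply True scaleR_fun_def algebra_simps)
  qed (simp add: lie_bracket_nonsmooth scaleR_fun_def tangent_nonsmooth[OF vfield_tangent[OF X U(2)]])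
qed

lemma lie_bracket_add_right:
  assumes "open U" "p \<in> U" "smooth_vfield A U X" "smooth_vfield A U Y" "smooth_vfield A U Z"
  shows "lie_bracket A X (\<lambda>q. Y q + Z q) p = lie_bracket A X Y p + lie_bracket A X Z p"
  using lie_bracket_add_left[OF assms(1,2,4,3,5)]
    lie_bracket_antisym[of X "\<lambda>q. Y q + Z q" p] lie_bracket_antisym[of X Y p]
    lie_bracket_antisym[of X Z p] by simp

lemma lie_bracket_scaleR_right:
  assumes "open U" "p \<in> U" "smooth_fun A U h" "smooth_vfield A U X" "smooth_vfield A U Y"
  shows "lie_bracket A X (\<lambda>q. h q *\<^sub>R Y q) p = h p *\<^sub>R lie_bracket A X Y p + X p h *\<^sub>R Y p"
  using lie_bracket_scaleR_left[OF assms(1,2,3,5,4)]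
    lie_bracket_antisym[of X "\<lambda>q. h q *\<^sub>R Y q" p] lie_bracket_antisym[of X Y p] by simp

lemma lie_bracket_jacobi:
  assumes U: "open U" "p \<in> U" and X: "smooth_vfield A U X" and Y: "smooth_vfield A U Y"
    and Z: "smooth_vfield A U Z"
  shows "lie_bracket A (lie_bracket A X Y) Z p + lie_bracket A (lie_bracket A Y Z) X p +
    lie_bracket A (lie_bracket A Z X) Y p = 0"
proof
  fix f
  show "(lie_bracket A (lie_bracket A X Y) Z p + lie_bracket A (lie_bracket A Y Z) X p +
    lie_bracket A (lie_bracket A Z X) Y p) f = 0 f"
  proof (cases "smooth_at A p f")
    case True
    then obtain W where W: "open W" "W \<subseteq> U" "p \<in> W" "smooth_fun A W f" using smooth_atE U by blast
    have S: "smooth_at A p (\<lambda>q. V q f)" if "smooth_vfield A U V" for V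
      using smooth_atI[OF W(1,3) vfield_fun[OF that W(1,2,4)]] .
    have *: "lie_bracket A (lie_bracket A V V') V'' p f =
        V p (\<lambda>q. V' q (\<lambda>q. V'' q f)) - V' p (\<lambda>q. V q (\<lambda>q. V'' q f)) -
        (V'' p (\<lambda>q. V q (\<lambda>q. V' q f)) - V'' p (\<lambda>q. V' q (\<lambda>q. V q f)))"
      if V: "smooth_vfield A U V" "smooth_vfield A U V'" "smooth_vfield A U V''" for V V' V''
    proof -
      \<comment> \<open>The bracket is cut off at functions that are not smooth. On \<open>W\<close>
        the cutoff is inactive and can be removed under \<open>V'' p\<close>; the twelve triple
        products then cancel in pairs.\<close>
      have "V'' p (\<lambda>q. lie_bracket A V V' q f) =
          V'' p (\<lambda>q. V q (\<lambda>q. V' q f) - V' q (\<lambda>q. V q f))"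
        by (rule tangent_cong[OF vfield_tangent[OF V(3) U(2)] W(1,3)])
          (simp add: lie_bracket_apply smooth_atI[OF W(1) _ W(4)])
      also have "\<dots> = V'' p (\<lambda>q. V q (\<lambda>q. V' q f)) - V'' p (\<lambda>q. V' q (\<lambda>q. V q f))"
        by (rule tangent_fun_diff[OF vfield_tangent[OF V(3) U(2)] W(1,3)])
          (use vfield_fun[OF _ W(1,2)] V W(4) in blast)+
      finally show ?thesis by (simp add: lie_bracket_apply True S[OF V(3)])
    qed
    show ?thesis by (simp add: *[OF X Y Z] *[OF Y Z X] *[OF Z X Y])
  qed (simp add: lie_bracket_nonsmooth)
qed

end

section \<open>The Levi-Civita connection as an operator on local fields\<close>

locale levi_civita_manifold = smooth_manifold A
  for A :: "('a::{t2_space,second_countable_topology}) chart set" +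
  fixes g :: "'a \<Rightarrow> 'a tvec \<Rightarrow> 'a tvec \<Rightarrow> real"
    and nabla :: "'a vfield \<Rightarrow> 'a vfield \<Rightarrow> 'a vfield"
  assumes metric: "pseudo_riemannian_metric A g" and LC: "levi_civita A g nabla"
begin

lemma
  assumes "u \<in> tangent_space A p" "v \<in> tangent_space A p"
  shows metric_sym: "g p u v = g p v u"
    and metric_scaleR_left: "g p (c *\<^sub>R u) v = c * g p u v"
    and metric_scaleR_right: "g p u (c *\<^sub>R v) = c * g p u v"
    and metric_add_left: "w \<in> tangent_space A p \<Longrightarrow> g p (u + w) v = g p u v + g p w v"
    and metric_add_right: "w \<in> tangent_space A p \<Longrightarrow> g p u (v + w) = g p u v + g p u w"
proof -
  have R: "g p u v = g p v u \<and> g p (u + w) v = g p u v + g p w v \<and> g p (c *\<^sub>R u) v = c * g p u v"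
    if "u \<in> tangent_space A p" "v \<in> tangent_space A p" "w \<in> tangent_space A p" for u v w c
    using metric that unfolding pseudo_riemannian_metric_def by metis
  show "g p u v = g p v u" "g p (c *\<^sub>R u) v = c * g p u v" "g p u (c *\<^sub>R v) = c * g p u v"
    using R[OF assms(1,2,1)] R[OF assms(2,1,1)] R[OF tangent_scaleR[OF assms(2)] assms(1) assms(1)]
    by metis+
  show "g p (u + w) v = g p u v + g p w v" if "w \<in> tangent_space A p"
    using R[OF assms that] by blast
  show "g p u (v + w) = g p u v + g p u w" if "w \<in> tangent_space A p"
    using R[OF assms(2,1) that] R[OF assms(1) tangent_add[OF assms(2) that] that] R[OF assms that]
      R[OF assms(1) that that] by metis
qed

lemma
  assumes "u \<in> tangent_space A p" "v \<in> tangent_space A p" "w \<in> tangent_space A p"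
  shows metric_diff_left: "g p (u - w) v = g p u v - g p w v"
    and metric_diff_right: "g p u (v - w) = g p u v - g p u w"
  using metric_add_left[OF assms(1,2) tangent_scaleR[OF assms(3)], of "-1"]
    metric_add_right[OF assms(1,2) tangent_scaleR[OF assms(3)], of "-1"]
    metric_scaleR_left[OF assms(3,2), of "-1"] metric_scaleR_right[OF assms(1,3), of "-1"]
  by simp_all

lemma
  assumes "u \<in> tangent_space A p" "v \<in> tangent_space A p"
  shows metric_uminus_left: "g p (- u) v = - g p u v"
    and metric_uminus_right: "g p u (- v) = - g p u v"
  using metric_scaleR_left[OF assms, of "-1"] metric_scaleR_right[OF assms, of "-1"] by simp_all

lemmas metric_simps = metric_scaleR_left metric_scaleR_right metric_add_left metric_add_right
  metric_diff_left metric_diff_right metric_uminus_left metric_uminus_right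
  tangent_scaleR tangent_add tangent_diff tangent_neg

lemma metric_smooth:
  "open U \<Longrightarrow> smooth_vfield A U X \<Longrightarrow> smooth_vfield A U Y \<Longrightarrow> smooth_fun A U (\<lambda>p. g p (X p) (Y p))"
  using metric unfolding pseudo_riemannian_metric_def by blast

lemma nabla_axioms:
  assumes "open U" "smooth_vfield A U X" "smooth_vfield A U Y" "smooth_vfield A U Z" "smooth_fun A U f"
  shows "smooth_vfield A U (nabla X Y)"
    and "p \<in> U \<Longrightarrow> nabla (\<lambda>q. X q + Z q) Y p = nabla X Y p + nabla Z Y p"
    and "p \<in> U \<Longrightarrow> nabla (\<lambda>q. f q *\<^sub>R X q) Y p = f p *\<^sub>R nabla X Y p"
    and "p \<in> U \<Longrightarrow> nabla X (\<lambda>q. Y q + Z q) p = nabla X Y p + nabla X Z p"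
    and "p \<in> U \<Longrightarrow> nabla X (\<lambda>q. f q *\<^sub>R Y q) p = X p f *\<^sub>R Y p + f p *\<^sub>R nabla X Y p"
    and "p \<in> U \<Longrightarrow> nabla X Y p - nabla Y X p = lie_bracket A X Y p"
    and "p \<in> U \<Longrightarrow> X p (\<lambda>q. g q (Y q) (Z q)) = g p (nabla X Y p) (Z p) + g p (Y p) (nabla X Z p)"
proof -
  have "affine_connection A nabla" using LC levi_civita_def by blast
  note * = this[unfolded affine_connection_def, rule_format, OF conjI[OF assms(1) conjI[OF assms(2)
      conjI[OF assms(3) conjI[OF assms(4,5)]]]]]
  show "smooth_vfield A U (nabla X Y)"
    "p \<in> U \<Longrightarrow> nabla (\<lambda>q. X q + Z q) Y p = nabla X Y p + nabla Z Y p"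
    "p \<in> U \<Longrightarrow> nabla (\<lambda>q. f q *\<^sub>R X q) Y p = f p *\<^sub>R nabla X Y p"
    "p \<in> U \<Longrightarrow> nabla X (\<lambda>q. Y q + Z q) p = nabla X Y p + nabla X Z p"
    "p \<in> U \<Longrightarrow> nabla X (\<lambda>q. f q *\<^sub>R Y q) p = X p f *\<^sub>R Y p + f p *\<^sub>R nabla X Y p"
    using * by blast+
  have "\<forall>p\<in>U. nabla X Y p - nabla Y X p = lie_bracket A X Y p \<and>
      X p (\<lambda>q. g q (Y q) (Z q)) = g p (nabla X Y p) (Z p) + g p (Y p) (nabla X Z p)"
    using LC assms(1-4) unfolding levi_civita_def by blast
  then show "p \<in> U \<Longrightarrow> nabla X Y p - nabla Y X p = lie_bracket A X Y p"
    "p \<in> U \<Longrightarrow> X p (\<lambda>q. g q (Y q) (Z q)) = g p (nabla X Y p) (Z p) + g p (Y p) (nabla X Z p)"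
    by blast+
qed

lemma nabla_smooth:
  "open U \<Longrightarrow> smooth_vfield A U X \<Longrightarrow> smooth_vfield A U Y \<Longrightarrow> smooth_vfield A U (nabla X Y)"
  using nabla_axioms(1)[OF _ _ _ _ smooth_fun_const] by blast

lemma nabla_add_left:
  "open U \<Longrightarrow> p \<in> U \<Longrightarrow> smooth_vfield A U X \<Longrightarrow> smooth_vfield A U Z \<Longrightarrow> smooth_vfield A U Y \<Longrightarrow>
    nabla (\<lambda>q. X q + Z q) Y p = nabla X Y p + nabla Z Y p"
  using nabla_axioms(2)[OF _ _ _ _ smooth_fun_const] by blast

lemma nabla_scaleR_left:
  "open U \<Longrightarrow> p \<in> U \<Longrightarrow> smooth_fun A U f \<Longrightarrow> smooth_vfield A U X \<Longrightarrow> smooth_vfield A U Y \<Longrightarrow>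
    nabla (\<lambda>q. f q *\<^sub>R X q) Y p = f p *\<^sub>R nabla X Y p"
  using nabla_axioms(3) by blast

lemma nabla_add_right:
  "open U \<Longrightarrow> p \<in> U \<Longrightarrow> smooth_vfield A U X \<Longrightarrow> smooth_vfield A U Y \<Longrightarrow> smooth_vfield A U Z \<Longrightarrow>
    nabla X (\<lambda>q. Y q + Z q) p = nabla X Y p + nabla X Z p"
  using nabla_axioms(4)[OF _ _ _ _ smooth_fun_const] by blast

lemma nabla_scaleR_right:
  "open U \<Longrightarrow> p \<in> U \<Longrightarrow> smooth_fun A U f \<Longrightarrow> smooth_vfield A U X \<Longrightarrow> smooth_vfield A U Y \<Longrightarrow>
    nabla X (\<lambda>q. f q *\<^sub>R Y q) p = X p f *\<^sub>R Y p + f p *\<^sub>R nabla X Y p"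
  using nabla_axioms(5) by blast

lemma nabla_torsion:
  "open U \<Longrightarrow> p \<in> U \<Longrightarrow> smooth_vfield A U X \<Longrightarrow> smooth_vfield A U Y \<Longrightarrow>
    nabla X Y p - nabla Y X p = lie_bracket A X Y p"
  using nabla_axioms(6)[OF _ _ _ _ smooth_fun_const] by blast

lemma nabla_metric:
  "open U \<Longrightarrow> p \<in> U \<Longrightarrow> smooth_vfield A U X \<Longrightarrow> smooth_vfield A U Y \<Longrightarrow> smooth_vfield A U Z \<Longrightarrow>
    X p (\<lambda>q. g q (Y q) (Z q)) = g p (nabla X Y p) (Z p) + g p (Y p) (nabla X Z p)"
  using nabla_axioms(7)[OF _ _ _ _ smooth_fun_const] by blast

text \<open>Torsion-freeness writes the bracket as a difference of two covariant derivatives, which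
  are smooth by the axioms of a connection.\<close>

lemma lie_bracket_smooth:
  assumes "open U" "smooth_vfield A U X" "smooth_vfield A U Y"
  shows "smooth_vfield A U (lie_bracket A X Y)"
proof (rule smooth_vfield_cong)
  show "nabla X Y q + (- 1) *\<^sub>R nabla Y X q = lie_bracket A X Y q" if "q \<in> U" for q
    using nabla_torsion[OF assms(1) that assms(2,3)] by simp
  show "smooth_vfield A U (\<lambda>q. nabla X Y q + (- 1) *\<^sub>R nabla Y X q)"
    by (intro smooth_vfield_add smooth_vfield_scaleR smooth_fun_const nabla_smooth assms)
qed

text \<open>A field \<open>Z\<close> that vanishes on \<open>U\<close> equals \<open>h Z\<close>, where \<open>h\<close> is the indicator function of the
  complement of \<open>U\<close>; this function is smooth on \<open>U\<close>.\<close>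

lemma nabla_cong:
  assumes U: "open U" "p \<in> U" and X: "smooth_vfield A U X" "smooth_vfield A U X'"
    and Y: "smooth_vfield A U Y" "smooth_vfield A U Y'"
    and eq: "\<And>q. q \<in> U \<Longrightarrow> X q = X' q" "\<And>q. q \<in> U \<Longrightarrow> Y q = Y' q"
  shows "nabla X Y p = nabla X' Y' p"
proof -
  define h :: "'a \<Rightarrow> real" where "h = indicator (- U)"
  have h: "smooth_fun A U h"
    by (rule smooth_fun_cong[OF U(1) _ smooth_fun_const[OF U(1), of 0]]) (simp add: h_def)
  have scale: "Z = (\<lambda>q. h q *\<^sub>R Z q)" if "\<And>q. q \<in> U \<Longrightarrow> Z q = 0" for Z :: "'a vfield"
    using that by (auto simp: h_def indicator_def fun_eq_iff)
  have h0: "h p = 0" using U(2) by (simp add: h_def)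
  have zero: "smooth_vfield A U Z" if "\<And>q. q \<in> U \<Longrightarrow> Z q = 0" for Z
    using smooth_vfield_cong[OF _ smooth_vfield_zero] that by metis
  define ZX where "ZX = (\<lambda>q. X' q - X q)"
  define ZY where "ZY = (\<lambda>q. Y' q - Y q)"
  have X0: "ZX q = 0" and Y0: "ZY q = 0" if "q \<in> U" for q
    using eq that by (auto simp: ZX_def ZY_def)
  have "nabla ZX Y' p = nabla (\<lambda>q. h q *\<^sub>R ZX q) Y' p"
    by (rule arg_cong[where f = "\<lambda>Z. nabla Z Y' p"], rule scale[OF X0])
  also have "\<dots> = 0" using nabla_scaleR_left[OF U h zero[OF X0] Y(2)] by (simp add: h0)
  finally have 1: "nabla ZX Y' p = 0" .
  have "nabla X ZY p = nabla X (\<lambda>q. h q *\<^sub>R ZY q) p"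
    by (rule arg_cong[where f = "\<lambda>Z. nabla X Z p"], rule scale[OF Y0])
  also have "\<dots> = 0"
    using nabla_scaleR_right[OF U h X(1) zero[OF Y0]] by (simp add: h0 Y0[OF U(2)])
  finally have 2: "nabla X ZY p = 0" .
  have "nabla X' Y' p = nabla (\<lambda>q. X q + ZX q) Y' p" by (simp add: ZX_def)
  also have "\<dots> = nabla X Y' p" using nabla_add_left[OF U X(1) zero[OF X0] Y(2)] by (simp add: 1)
  also have "\<dots> = nabla X (\<lambda>q. Y q + ZY q) p" by (simp add: ZY_def)
  also have "\<dots> = nabla X Y p" using nabla_add_right[OF U X(1) Y(1) zero[OF Y0]] by (simp add: 2)
  finally show ?thesis by simp
qed

section \<open>Tensoriality of the Lie derivative of the connection\<close>

context
  fixes V :: "'a vfield" and U :: "'a set"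
  assumes V: "smooth_vfield A U V" and U: "open U"
begin

lemma lie_deriv_connection_cong:
  assumes "p \<in> U" "smooth_vfield A U X" "smooth_vfield A U X'" "smooth_vfield A U Y" "smooth_vfield A U Y'"
    "\<And>q. q \<in> U \<Longrightarrow> X q = X' q" "\<And>q. q \<in> U \<Longrightarrow> Y q = Y' q"
  shows "lie_deriv_connection A nabla V X Y p = lie_deriv_connection A nabla V X' Y' p"
proof -
  have b: "lie_bracket A V Z q = lie_bracket A V Z' q"
    if "\<And>q. q \<in> U \<Longrightarrow> Z q = Z' q" "q \<in> U" "smooth_vfield A U Z" for Z Z' q
    by (rule lie_bracket_cong[where X = V and X' = V and Y = Z and Y' = Z', OF U that(2) refl that(1)
          vfield_tangent[OF V that(2)] vfield_tangent[OF that(3,2)]])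
  have 1: "lie_bracket A V (nabla X Y) p = lie_bracket A V (nabla X' Y') p"
    by (rule b) (use assms U in \<open>auto intro: nabla_cong nabla_smooth\<close>)
  have 2: "nabla (lie_bracket A V X) Y p = nabla (lie_bracket A V X') Y' p"
    by (rule nabla_cong[OF U assms(1)]) (use assms U V in \<open>auto intro: lie_bracket_smooth b\<close>)
  have 3: "nabla X (lie_bracket A V Y) p = nabla X' (lie_bracket A V Y') p"
    by (rule nabla_cong[OF U assms(1)]) (use assms U V in \<open>auto intro: lie_bracket_smooth b\<close>)
  show ?thesis by (simp add: lie_deriv_connection_def 1 2 3)
qed

lemma lie_deriv_connection_add_left:
  assumes p: "p \<in> U" and X: "smooth_vfield A U X" and Z: "smooth_vfield A U Z" and Y: "smooth_vfield A U Y"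
  shows "lie_deriv_connection A nabla V (\<lambda>q. X q + Z q) Y p =
    lie_deriv_connection A nabla V X Y p + lie_deriv_connection A nabla V Z Y p"
proof -
  note s = smooth_vfield_add nabla_smooth[OF U] lie_bracket_smooth[OF U]
  have "lie_bracket A V (nabla (\<lambda>q. X q + Z q) Y) p =
      lie_bracket A V (\<lambda>q. nabla X Y q + nabla Z Y q) p"
    by (rule lie_bracket_cong[OF U p])
      (use X Y Z V p in \<open>auto intro: vfield_tangent s nabla_add_left[OF U]\<close>)
  moreover have "nabla (lie_bracket A V (\<lambda>q. X q + Z q)) Y p =
      nabla (\<lambda>q. lie_bracket A V X q + lie_bracket A V Z q) Y p"
    by (rule nabla_cong[OF U p]) (use X Y Z V in \<open>auto intro: s lie_bracket_add_right[OF U]\<close>)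
  ultimately show ?thesis
    using X Y Z V
    by (simp add: lie_deriv_connection_def lie_bracket_add_right[OF U p] nabla_add_left[OF U p] s)
qed

lemma lie_deriv_connection_add_right:
  assumes p: "p \<in> U" and X: "smooth_vfield A U X" and Y: "smooth_vfield A U Y" and Z: "smooth_vfield A U Z"
  shows "lie_deriv_connection A nabla V X (\<lambda>q. Y q + Z q) p =
    lie_deriv_connection A nabla V X Y p + lie_deriv_connection A nabla V X Z p"
proof -
  note s = smooth_vfield_add nabla_smooth[OF U] lie_bracket_smooth[OF U]
  have "lie_bracket A V (nabla X (\<lambda>q. Y q + Z q)) p =
      lie_bracket A V (\<lambda>q. nabla X Y q + nabla X Z q) p"
    by (rule lie_bracket_cong[OF U p])
      (use X Y Z V p in \<open>auto intro: vfield_tangent s nabla_add_right[OF U]\<close>)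
  moreover have "nabla X (lie_bracket A V (\<lambda>q. Y q + Z q)) p =
      nabla X (\<lambda>q. lie_bracket A V Y q + lie_bracket A V Z q) p"
    by (rule nabla_cong[OF U p]) (use X Y Z V in \<open>auto intro: s lie_bracket_add_right[OF U]\<close>)
  ultimately show ?thesis
    using X Y Z V
    by (simp add: lie_deriv_connection_def lie_bracket_add_right[OF U p] nabla_add_right[OF U p] s)
qed

text \<open>The bracket of \<open>V\<close> with \<open>f \<nabla>_X Y\<close> and the covariant
  derivative of \<open>Y\<close> along \<open>[V, f X]\<close> both contribute
  \<open>(V f) \<nabla>_X Y\<close>, and these cancel.\<close>

lemma lie_deriv_connection_scaleR_left:
  assumes p: "p \<in> U" and f: "smooth_fun A U f" and X: "smooth_vfield A U X" and Y: "smooth_vfield A U Y"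
  shows "lie_deriv_connection A nabla V (\<lambda>q. f q *\<^sub>R X q) Y p =
    f p *\<^sub>R lie_deriv_connection A nabla V X Y p"
proof -
  note s = smooth_vfield_add smooth_vfield_scaleR[OF f] nabla_smooth[OF U] lie_bracket_smooth[OF U]
  have Vf: "smooth_fun A U (\<lambda>q. V q f)" using vfield_fun[OF V U _ f] by simp
  have "lie_bracket A V (nabla (\<lambda>q. f q *\<^sub>R X q) Y) p =
      lie_bracket A V (\<lambda>q. f q *\<^sub>R nabla X Y q) p"
    by (rule lie_bracket_cong[OF U p])
      (use X Y V p f in \<open>auto intro: vfield_tangent s nabla_scaleR_left[OF U]\<close>)
  moreover have "nabla (lie_bracket A V (\<lambda>q. f q *\<^sub>R X q)) Y p =
      nabla (\<lambda>q. f q *\<^sub>R lie_bracket A V X q + V q f *\<^sub>R X q) Y p"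
    by (rule nabla_cong[OF U p])
      (intro smooth_vfield_add smooth_vfield_scaleR lie_bracket_smooth U V X Y f Vf |
        simp add: lie_bracket_scaleR_right[OF U _ f V] X Y)+
  ultimately show ?thesis
    using X Y V f
    by (simp add: lie_deriv_connection_def lie_bracket_scaleR_right[OF U p] nabla_add_left[OF U p]
        nabla_scaleR_left[OF U p] s smooth_vfield_scaleR[OF Vf] Vf algebra_simps)
qed

text \<open>The terms with a single derivative of \<open>f\<close> cancel in pairs. What remains is
  \<open>V (X f) - X (V f) - [V, X] f\<close> times \<open>Y\<close>, which vanishes by definition
  of the bracket.\<close>

lemma lie_deriv_connection_scaleR_right:
  assumes p: "p \<in> U" and f: "smooth_fun A U f" and X: "smooth_vfield A U X" and Y: "smooth_vfield A U Y"
  shows "lie_deriv_connection A nabla V X (\<lambda>q. f q *\<^sub>R Y q) p =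
    f p *\<^sub>R lie_deriv_connection A nabla V X Y p"
proof -
  note s = smooth_vfield_add smooth_vfield_scaleR[OF f] nabla_smooth[OF U] lie_bracket_smooth[OF U]
  have Vf: "smooth_fun A U (\<lambda>q. V q f)" and Xf: "smooth_fun A U (\<lambda>q. X q f)"
    using vfield_fun[OF V U _ f] vfield_fun[OF X U _ f] by simp_all
  have "lie_bracket A V (nabla X (\<lambda>q. f q *\<^sub>R Y q)) p =
      lie_bracket A V (\<lambda>q. X q f *\<^sub>R Y q + f q *\<^sub>R nabla X Y q) p"
    by (rule lie_bracket_cong[OF U p])
      (use X Y V p f in \<open>auto intro: vfield_tangent s nabla_scaleR_right[OF U]\<close>)
  moreover have "nabla X (lie_bracket A V (\<lambda>q. f q *\<^sub>R Y q)) p =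
      nabla X (\<lambda>q. f q *\<^sub>R lie_bracket A V Y q + V q f *\<^sub>R Y q) p"
    by (rule nabla_cong[OF U p])
      (intro smooth_vfield_add smooth_vfield_scaleR lie_bracket_smooth U V X Y f Vf |
        simp add: lie_bracket_scaleR_right[OF U _ f V] X Y)+
  moreover have "V p (\<lambda>q. X q f) = lie_bracket A V X p f + X p (\<lambda>q. V q f)"
    using lie_bracket_apply[OF smooth_atI[OF U p f]] by simp
  ultimately show ?thesis
    using X Y V f
    by (simp add: lie_deriv_connection_def lie_bracket_scaleR_right[OF U p] nabla_add_right[OF U p]
        nabla_scaleR_right[OF U p] lie_bracket_add_right[OF U p] s smooth_vfield_scaleR[OF Vf]
        smooth_vfield_scaleR[OF Xf] Vf Xf algebra_simps)
qed

lemma smooth_vfield_combination: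
  assumes F: "\<And>j. smooth_vfield A U (F j)" and c: "\<And>j. smooth_fun A U (c j)"
  shows "finite J \<Longrightarrow> smooth_vfield A U (\<lambda>q. \<Sum>j\<in>J. c j q *\<^sub>R F j q)"
proof (induction J rule: finite_induct)
  case empty
  show ?case using smooth_vfield_zero by (simp add: zero_fun_def)
next
  case (insert j J)
  then show ?case using smooth_vfield_add[OF smooth_vfield_scaleR[OF c F] insert(3)]
    by (simp only: sum.insert[OF insert(1,2)])
qed

lemma lie_deriv_connection_combination_left:
  assumes p: "p \<in> U" and Y: "smooth_vfield A U Y"
    and F: "\<And>j. smooth_vfield A U (F j)" and c: "\<And>j. smooth_fun A U (c j)"
  shows "finite J \<Longrightarrow> lie_deriv_connection A nabla V (\<lambda>q. \<Sum>j\<in>J. c j q *\<^sub>R F j q) Y p =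
    (\<Sum>j\<in>J. c j p *\<^sub>R lie_deriv_connection A nabla V (F j) Y p)"
proof (induction J rule: finite_induct)
  case empty
  show ?case
    using lie_deriv_connection_scaleR_left[OF p smooth_fun_const[OF U, of 0] Y Y] by (simp add: zero_fun_def)
next
  case (insert j J)
  then show ?case
    using lie_deriv_connection_add_left[OF p smooth_vfield_scaleR[OF c F]
        smooth_vfield_combination[OF F c insert(1)] Y]
    by (simp only: sum.insert[OF insert(1,2)] lie_deriv_connection_scaleR_left[OF p c F Y])
qed

lemma lie_deriv_connection_combination_right:
  assumes p: "p \<in> U" and Y: "smooth_vfield A U Y"
    and F: "\<And>j. smooth_vfield A U (F j)" and c: "\<And>j. smooth_fun A U (c j)"
  shows "finite J \<Longrightarrow> lie_deriv_connection A nabla V Y (\<lambda>q. \<Sum>j\<in>J. c j q *\<^sub>R F j q) p =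
    (\<Sum>j\<in>J. c j p *\<^sub>R lie_deriv_connection A nabla V Y (F j) p)"
proof (induction J rule: finite_induct)
  case empty
  show ?case
    using lie_deriv_connection_scaleR_right[OF p smooth_fun_const[OF U, of 0] Y Y] by (simp add: zero_fun_def)
next
  case (insert j J)
  then show ?case
    using lie_deriv_connection_add_right[OF p Y smooth_vfield_scaleR[OF c F]
        smooth_vfield_combination[OF F c insert(1)]]
    by (simp only: sum.insert[OF insert(1,2)] lie_deriv_connection_scaleR_right[OF p c Y F])
qed

end

end

text \<open>If \<open>c t c\<^sup>T = s\<close> for diagonal sign matrices \<open>s\<close> and \<open>t\<close>, then \<open>c\<close> has the inverse
  \<open>t c\<^sup>T s\<close>, and hence \<open>c\<^sup>T s c = t\<close>.\<close>

lemma pseudo_orthogonal_transpose: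
  fixes c :: "'n::finite \<Rightarrow> 'n \<Rightarrow> real" and s t :: "'n \<Rightarrow> real"
  assumes s: "\<And>i. s i \<in> {1, -1}" and t: "\<And>i. t i \<in> {1, -1}"
    and c: "\<And>i j. (\<Sum>k\<in>UNIV. c i k * t k * c j k) = (if i = j then s i else 0)"
  shows "(\<Sum>i\<in>UNIV. s i * c i j * c i k) = (if j = k then t j else 0)"
proof -
  have sq: "s i * s i = 1" "t i * t i = 1" for i using s[of i] t[of i] by auto
  define M N :: "real^'n^'n" where "M = (\<chi> i k. c i k)" and "N = (\<chi> k j. t k * c j k * s j)"
  have "(M ** N) $ i $ j = mat 1 $ i $ j" for i j
  proof -
    have "(M ** N) $ i $ j = (\<Sum>k\<in>UNIV. c i k * t k * c j k) * s j"
      by (simp add: M_def N_def matrix_matrix_mult_def sum_distrib_left sum_distrib_right mult_ac)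
    then show ?thesis by (simp add: c mat_def sq)
  qed
  then have "M ** N = mat 1" by (simp add: vec_eq_iff)
  then have "N ** M = mat 1" using matrix_left_right_inverse by blast
  then have "(N ** M) $ j $ k = mat 1 $ j $ k" by simp
  moreover have "(N ** M) $ j $ k = t j * (\<Sum>i\<in>UNIV. s i * c i j * c i k)"
    by (simp add: M_def N_def matrix_matrix_mult_def sum_distrib_left mult_ac)
  ultimately have "t j * (t j * (\<Sum>i\<in>UNIV. s i * c i j * c i k)) = t j * (if j = k then 1 else 0)"
    by (simp add: mat_def)
  then show ?thesis using sq(2)[of j] by (simp flip: mult.assoc)
qed

context levi_civita_manifold
begin

text \<open>Pairing the expansions of two vectors of \<open>E\<close> gives
  \<open>c t c^T = s\<close> for the change of frame \<open>c\<close>, and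
  \<open>pseudo_orthogonal_transpose\<close> turns this into the relation that collapses the double
  sum over \<open>F\<close>. An expansion is assumed for \<open>F\<close> alone, because in the
  application only the \<phi>-basis is known to span.\<close>

lemma trace_frame_independent:
  assumes V: "smooth_vfield A UNIV V"
    and F: "pseudo_orthonormal_frame A g U F t" and E: "pseudo_orthonormal_frame A g U' E s"
    and p: "p \<in> U" "p \<in> U'"
    and span: "\<And>q v. q \<in> U \<Longrightarrow> v \<in> tangent_space A q \<Longrightarrow>
      v = (\<Sum>j\<in>UNIV. (t j * g q v (F j q)) *\<^sub>R F j q)"
  shows "(\<Sum>i\<in>UNIV. s i *\<^sub>R lie_deriv_connection A nabla V (E i) (E i) p) =
    (\<Sum>j\<in>UNIV. t j *\<^sub>R lie_deriv_connection A nabla V (F j) (F j) p)"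
proof -
  let ?W = "U \<inter> U'" and ?T = "\<lambda>X Y. lie_deriv_connection A nabla V X Y p"
  have W: "open ?W" "p \<in> ?W" using E F p by (auto simp: pseudo_orthonormal_frame_def)
  have st: "s i \<in> {1, -1}" "t i \<in> {1, -1}" for i
    using E F by (simp_all add: pseudo_orthonormal_frame_def)
  have VW: "smooth_vfield A ?W V" using smooth_vfield_subset[OF V] by simp
  have EF: "smooth_vfield A ?W (E i)" "smooth_vfield A ?W (F i)" for i
    using E F smooth_vfield_subset[of U' "E i"] smooth_vfield_subset[of U "F i"]
    by (simp_all add: pseudo_orthonormal_frame_def)
  define c where "c = (\<lambda>i j q. t j * g q (E i q) (F j q))"
  have c: "smooth_fun A ?W (c i j)" for i j
    unfolding c_def by (intro smooth_fun_mult smooth_fun_const metric_smooth W EF)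
  have exp: "E i q = (\<Sum>j\<in>UNIV. c i j q *\<^sub>R F j q)" if "q \<in> ?W" for i q
    unfolding c_def using span that vfield_tangent[OF EF(1) that] by blast
  have "?T (E i) (E i) = (\<Sum>j\<in>UNIV. \<Sum>k\<in>UNIV. (c i j p * c i k p) *\<^sub>R ?T (F j) (F k))" for i
  proof -
    note comb = smooth_vfield_combination[OF VW W(1) EF(2) c finite]
    have "?T (E i) (E i) =
        ?T (\<lambda>q. \<Sum>j\<in>UNIV. c i j q *\<^sub>R F j q) (\<lambda>q. \<Sum>j\<in>UNIV. c i j q *\<^sub>R F j q)"
      by (rule lie_deriv_connection_cong[OF VW W EF(1) comb EF(1) comb]) (simp_all add: exp)
    then show ?thesis
      by (simp add: lie_deriv_connection_combination_left[OF VW W comb EF(2) c]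
          lie_deriv_connection_combination_right[OF VW W EF(2) EF(2) c] scaleR_sum_right)
  qed
  then have "(\<Sum>i\<in>UNIV. s i *\<^sub>R ?T (E i) (E i)) =
      (\<Sum>i\<in>UNIV. \<Sum>j\<in>UNIV. \<Sum>k\<in>UNIV. (s i * c i j p * c i k p) *\<^sub>R ?T (F j) (F k))"
    by (simp add: scaleR_sum_right mult.assoc)
  also have "\<dots> = (\<Sum>j\<in>UNIV. \<Sum>k\<in>UNIV. (\<Sum>i\<in>UNIV. s i * c i j p * c i k p) *\<^sub>R ?T (F j) (F k))"
    by (subst sum.swap, rule sum.cong[OF refl], subst sum.swap) (simp add: scaleR_sum_left)
  also have "\<dots> = (\<Sum>j\<in>UNIV. \<Sum>k\<in>UNIV. (if j = k then t j else 0) *\<^sub>R ?T (F j) (F k))"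
  proof (intro sum.cong refl arg_cong2[where f = scaleR] pseudo_orthogonal_transpose st)
    fix i j
    have tE: "E i p \<in> tangent_space A p" and tF: "F i p \<in> tangent_space A p" for i
      using vfield_tangent[OF _ W(2)] EF by blast+
    \<comment> \<open>The sign in the definition of \<open>c\<close> cancels against
      \<open>t k\<close>.\<close>
    have gc: "t k * c j k p = g p (F k p) (E j p)" for k
      using st(2)[of k] metric_sym[OF tE tF] by (auto simp: c_def)
    have "g p (E i p) (E j p) = g p (\<Sum>k\<in>UNIV. c i k p *\<^sub>R F k p) (E j p)"
      using exp[OF W(2)] by metis
    also have "\<dots> = (\<Sum>k\<in>UNIV. c i k p * g p (F k p) (E j p))"
      by (simp add: sum_3 metric_simps tE tF)
    also have "\<dots> = (\<Sum>k\<in>UNIV. c i k p * t k * c j k p)"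
      by (simp add: gc[symmetric] mult.assoc)
    finally show "(\<Sum>k\<in>UNIV. c i k p * t k * c j k p) = (if i = j then s i else 0)"
      using E p(2) by (simp add: pseudo_orthonormal_frame_def)
  qed
  also have "\<dots> = (\<Sum>j\<in>UNIV. t j *\<^sub>R ?T (F j) (F j))"
    by (simp add: if_distrib[of "\<lambda>x. x *\<^sub>R _"] sum.delta cong: if_cong)
  finally show ?thesis .
qed

end

section \<open>Paracontact metric manifolds\<close>

lemma dim_1_multiple:
  fixes S :: "'b::real_vector set"
  assumes "dim S = 1"
  obtains b where "b \<in> S" "b \<noteq> 0" "\<And>x. x \<in> S \<Longrightarrow> \<exists>c. x = c *\<^sub>R b"
proof -
  obtain B where B: "B \<subseteq> S" "independent B" "S \<subseteq> span B" "card B = dim S"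
    using real_vector.basis_exists by blast
  then obtain b where b: "B = {b}" using assms card_1_singletonE by metis
  show ?thesis
    by (rule that[of b]) (use B b in \<open>auto simp: real_vector.span_singleton\<close>)
qed

lemma (in levi_civita_manifold) metric_nondegenerate:
  assumes "v \<in> tangent_space A p" "\<And>w. w \<in> tangent_space A p \<Longrightarrow> g p v w = 0"
  shows "v = 0"
proof -
  have "\<forall>p. \<forall>v\<in>tangent_space A p. (\<forall>w\<in>tangent_space A p. g p v w = 0) \<longrightarrow> v = 0"
    using metric by (simp add: pseudo_riemannian_metric_def)
  then show ?thesis using assms by simp
qed

lemma (in smooth_manifold) open_smooth_preimage:
  assumes "open W" "smooth_fun A W h" "open B"
  shows "open {q \<in> W. h q \<in> B}"
proof -
  have "open (h -` B \<inter> W)"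
    using smooth_fun_continuous_on[OF assms(1,2)] continuous_on_open_vimage[OF assms(1)] assms(3) by blast
  then show ?thesis by (simp add: vimage_def Int_def conj_commute)
qed

locale paracontact_manifold = levi_civita_manifold A g nabla
  for A :: "('a::{t2_space,second_countable_topology}) chart set" and g and nabla +
  fixes \<phi> :: "'a \<Rightarrow> 'a tvec \<Rightarrow> 'a tvec"
    and \<xi> :: "'a vfield"
    and \<eta> :: "'a \<Rightarrow> 'a tvec \<Rightarrow> real"
  assumes paracontact: "paracontact_metric_manifold A \<phi> \<xi> \<eta> g"
begin

lemma almost: "almost_paracontact A \<phi> \<xi> \<eta>"
  using paracontact by (simp add: paracontact_metric_manifold_def)

lemma reeb_smooth: "smooth_vfield A UNIV \<xi>"
  using almost by (simp add: almost_paracontact_def)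

lemma reeb_smooth_on: "smooth_vfield A U \<xi>"
  using smooth_vfield_subset[OF reeb_smooth] by simp

lemma reeb_tangent: "\<xi> p \<in> tangent_space A p"
  using vfield_tangent[OF reeb_smooth] by simp

lemma phi_reeb: "\<phi> p (\<xi> p) = 0" and eta_reeb: "\<eta> p (\<xi> p) = 1"
  using almost by (simp_all add: almost_paracontact_def)

lemma dim_eigenspaces:
  "dim {v \<in> tangent_space A p. \<eta> p v = 0 \<and> \<phi> p v = v} = 1"
  "dim {v \<in> tangent_space A p. \<eta> p v = 0 \<and> \<phi> p v = - v} = 1"
  using almost by (simp_all add: almost_paracontact_def)

lemma phi_smooth: "open U \<Longrightarrow> smooth_vfield A U X \<Longrightarrow> smooth_vfield A U (\<lambda>p. \<phi> p (X p))"
  using almost by (simp add: almost_paracontact_def tensor11_def)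

lemma
  assumes "v \<in> tangent_space A p"
  shows phi_tangent: "\<phi> p v \<in> tangent_space A p"
    and eta_phi: "\<eta> p (\<phi> p v) = 0"
    and phi_phi: "\<phi> p (\<phi> p v) = v - \<eta> p v *\<^sub>R \<xi> p"
    and phi_scaleR: "\<phi> p (c *\<^sub>R v) = c *\<^sub>R \<phi> p v"
    and phi_add: "w \<in> tangent_space A p \<Longrightarrow> \<phi> p (v + w) = \<phi> p v + \<phi> p w"
    and compatible: "w \<in> tangent_space A p \<Longrightarrow> g p (\<phi> p v) (\<phi> p w) = - g p v w + \<eta> p v * \<eta> p w"
proof -
  show "\<phi> p v \<in> tangent_space A p" "\<eta> p (\<phi> p v) = 0" "\<phi> p (\<phi> p v) = v - \<eta> p v *\<^sub>R \<xi> p"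
    using almost assms by (simp_all add: almost_paracontact_def tensor11_def)
  have "tensor11 A \<phi>" using almost by (simp add: almost_paracontact_def)
  then show "\<phi> p (c *\<^sub>R v) = c *\<^sub>R \<phi> p v"
    "w \<in> tangent_space A p \<Longrightarrow> \<phi> p (v + w) = \<phi> p v + \<phi> p w"
    using assms unfolding tensor11_def by blast+
  show "w \<in> tangent_space A p \<Longrightarrow> g p (\<phi> p v) (\<phi> p w) = - g p v w + \<eta> p v * \<eta> p w"
    using paracontact assms by (simp add: paracontact_metric_manifold_def)
qed

text \<open>Compatibility is applied to \<xi> and \<open>v\<close>: its left side vanishes because
  \<phi> kills \<xi>. The zero vector is written as a multiple of \<xi>, so that homogeneity of
  \<open>g\<close> applies.\<close>

lemma eta_metric:
  assumes "v \<in> tangent_space A p"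
  shows "\<eta> p v = g p (\<xi> p) v"
proof -
  have "g p (0 *\<^sub>R \<xi> p) (\<phi> p v) = 0"
    using metric_scaleR_left[OF reeb_tangent phi_tangent[OF assms], of 0] by simp
  then show ?thesis using compatible[OF reeb_tangent assms] by (simp add: phi_reeb eta_reeb)
qed

lemma reeb_unit: "g p (\<xi> p) (\<xi> p) = 1"
  using eta_metric[OF reeb_tangent, of p] eta_reeb[of p] by simp

text \<open>For constant \<eta>-components both derivative terms of \<open>ext_d\<close> vanish, and
  the contact condition yields the \<xi>-component of the bracket. The factor 2 undoes the 1/2 in
  the convention.\<close>

lemma eta_lie_bracket:
  assumes U: "open U" "p \<in> U" and X: "smooth_vfield A U X" and Y: "smooth_vfield A U Y"
    and cX: "\<And>q. q \<in> U \<Longrightarrow> \<eta> q (X q) = a" and cY: "\<And>q. q \<in> U \<Longrightarrow> \<eta> q (Y q) = b"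
  shows "g p (\<xi> p) (lie_bracket A X Y p) = - 2 * g p (X p) (\<phi> p (Y p))"
proof -
  have "ext_d A \<eta> X Y p = g p (X p) (\<phi> p (Y p))"
    using paracontact U X Y unfolding paracontact_metric_manifold_def by blast
  moreover have "X p (\<lambda>q. \<eta> q (Y q)) = X p (\<lambda>q. b)" "Y p (\<lambda>q. \<eta> q (X q)) = Y p (\<lambda>q. a)"
    by (rule tangent_cong[OF vfield_tangent[OF X U(2)] U], simp add: cY)
      (rule tangent_cong[OF vfield_tangent[OF Y U(2)] U], simp add: cX)
  moreover have "\<eta> p (lie_bracket A X Y p) = g p (\<xi> p) (lie_bracket A X Y p)"
    by (rule eta_metric[OF vfield_tangent[OF lie_bracket_smooth[OF U(1) X Y] U(2)]])
  ultimately show ?thesis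
    using tangent_const[OF vfield_tangent[OF X U(2)]] tangent_const[OF vfield_tangent[OF Y U(2)]]
    by (simp add: ext_d_def)
qed

text \<open>A vector \<open>n\<close> in the eigenline for 1 is null, since compatibility gives
  \<open>g n n = - g n n\<close>. By nondegeneracy some \<open>w\<close> pairs nontrivially with it;
  adding multiples of \<open>n\<close> to the part of \<open>w\<close> orthogonal to \<xi> changes
  the square linearly, so every value is attained.\<close>

lemma spacelike_vector_ex:
  "\<exists>v\<in>tangent_space A p. g p (\<xi> p) v = 0 \<and> g p v v > 0"
proof -
  obtain n where n: "n \<in> tangent_space A p" "\<eta> p n = 0" "\<phi> p n = n" "n \<noteq> 0"
    by (rule dim_1_multiple[OF dim_eigenspaces(1)[of p]]) auto
  have nn: "g p n n = 0" using compatible[OF n(1,1)] n by simp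
  obtain w where w: "w \<in> tangent_space A p" "g p n w \<noteq> 0"
    using metric_nondegenerate[OF n(1)] n(4) by blast
  define w' where "w' = w + (- g p (\<xi> p) w) *\<^sub>R \<xi> p"
  have w': "w' \<in> tangent_space A p"
    unfolding w'_def by (intro tangent_add tangent_scaleR w reeb_tangent)
  have rn: "g p (\<xi> p) n = 0" "g p n (\<xi> p) = 0"
    using eta_metric[OF n(1)] metric_sym[OF n(1) reeb_tangent] n by simp_all
  have rw': "g p (\<xi> p) w' = 0" "g p n w' = g p n w"
    unfolding w'_def using w n(1) rn reeb_unit reeb_tangent by (simp_all add: metric_simps)
  \<comment> \<open>The square of \<open>w' + t n\<close> is \<open>g w' w' + 2 t g n w\<close>, and
    this \<open>t\<close> makes it 1.\<close>
  define t where "t = (1 - g p w' w') / (2 * g p n w)"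
  have "g p (w' + t *\<^sub>R n) (w' + t *\<^sub>R n) = 1"
    using w w' n(1) nn rw' metric_sym[OF w' n(1)] by (simp add: metric_simps t_def)
  moreover have "g p (\<xi> p) (w' + t *\<^sub>R n) = 0"
    using w' n(1) rn rw' reeb_tangent by (simp add: metric_simps)
  moreover have "w' + t *\<^sub>R n \<in> tangent_space A p" by (intro tangent_add tangent_scaleR w' n)
  ultimately show ?thesis by (metis zero_less_one)
qed

text \<open>Being space-like is an open condition: a space-like vector at \<open>p\<close>, extended
  with constant coefficients in a chart and freed of its \<xi>-component, stays space-like near
  \<open>p\<close> and can be normalised there.\<close>

lemma phi_basis_ex: "\<exists>U e. p \<in> U \<and> phi_basis A \<phi> \<xi> g U e"
proof -
  obtain v where v: "v \<in> tangent_space A p" "g p (\<xi> p) v = 0" "g p v v > 0"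
    using spacelike_vector_ex by blast
  obtain V \<kappa> where V: "(V, \<kappa>) \<in> A" "p \<in> V" using chart_ex by blast
  obtain w where w: "v = dir_deriv A (V, \<kappa>) p w" using v(1) tangent_space_chart[OF V] by auto
  define X where "X = (\<lambda>q. dir_deriv A (V, \<kappa>) q w)"
  have oV: "open V" using chart_open V by blast
  have X: "smooth_vfield A V X" unfolding X_def by (rule smooth_vfield_coordinate[OF V(1)])
  define Y where "Y = (\<lambda>q. X q + (- g q (\<xi> q) (X q)) *\<^sub>R \<xi> q)"
  have Y: "smooth_vfield A V Y"
    unfolding Y_def
    by (intro smooth_vfield_add smooth_vfield_scaleR smooth_fun_uminus metric_smooth X reeb_smooth_on oV)
  have rY: "g q (\<xi> q) (Y q) = 0" if "q \<in> V" for q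
    using vfield_tangent[OF X that] reeb_tangent[of q]
    by (simp add: Y_def metric_simps reeb_unit)
  have Yp: "Y p = v" using v(2) by (simp add: Y_def X_def w)
  define n where "n = (\<lambda>q. g q (Y q) (Y q))"
  have n: "smooth_fun A V n" unfolding n_def by (rule metric_smooth[OF oV Y Y])
  define U where "U = {q \<in> V. n q \<in> {0<..}}"
  have U: "open U"
    unfolding U_def by (rule open_smooth_preimage[OF oV n]) simp
  have UV: "U \<subseteq> V" and np: "\<And>q. q \<in> U \<Longrightarrow> n q > 0" by (auto simp: U_def)
  define e where "e = (\<lambda>q. n q powr (- 1 / 2) *\<^sub>R Y q)"
  have e: "smooth_vfield A U e"
    unfolding e_def
    by (intro smooth_vfield_scaleR smooth_fun_powr np U smooth_fun_subset[OF n UV]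
        smooth_vfield_subset[OF Y UV])
  have "g q (\<xi> q) (\<xi> q) = 1 \<and> g q (e q) (e q) = 1 \<and> g q (\<phi> q (e q)) (\<phi> q (e q)) = -1 \<and>
      g q (\<xi> q) (e q) = 0 \<and> g q (\<xi> q) (\<phi> q (e q)) = 0 \<and> g q (e q) (\<phi> q (e q)) = 0"
    if q: "q \<in> U" for q
  proof -
    have qV: "q \<in> V" using q UV by blast
    have tY: "Y q \<in> tangent_space A q" using vfield_tangent[OF Y qV] .
    have te: "e q \<in> tangent_space A q" using vfield_tangent[OF e q] .
    have re: "g q (\<xi> q) (e q) = 0"
      using rY[OF qV] by (simp add: e_def metric_simps tY reeb_tangent)
    have "g q (e q) (e q) = n q powr (- 1 / 2) * n q powr (- 1 / 2) * n q"
      by (simp add: e_def metric_simps tY n_def)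
    also have "\<dots> = 1"
      unfolding powr_add[symmetric] using np[OF q] by (simp add: powr_minus)
    finally have ee: "g q (e q) (e q) = 1" .
    have eta: "\<eta> q (e q) = 0" using eta_metric[OF te] re by simp
    \<comment> \<open>Since \<open>\<phi> (\<phi> e) = e\<close>, this makes
      \<open>g e (\<phi> e)\<close> equal to its own negative.\<close>
    have "g q (\<phi> q (e q)) (\<phi> q (\<phi> q (e q))) = - g q (e q) (\<phi> q (e q))"
      using compatible[OF te phi_tangent[OF te]] by (simp add: eta)
    then have "g q (e q) (\<phi> q (e q)) = 0"
      using metric_sym[OF te phi_tangent[OF te]] by (simp add: phi_phi[OF te] eta)
    then show ?thesis
      using ee re compatible[OF te te] eta reeb_unit
        eta_metric[OF phi_tangent[OF te]] eta_phi[OF te] by simp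
  qed
  then have "phi_basis A \<phi> \<xi> g U e" using U e by (simp add: phi_basis_def)
  moreover have "p \<in> U" using v(3) V by (simp add: U_def n_def Yp)
  ultimately show ?thesis by blast
qed

end

section \<open>Local frames\<close>

locale phi_frame = paracontact_manifold A g nabla \<phi> \<xi> \<eta>
  for A :: "('a::{t2_space,second_countable_topology}) chart set" and g nabla \<phi> \<xi> \<eta> +
  fixes U :: "'a set" and e :: "'a vfield"
  assumes basis: "phi_basis A \<phi> \<xi> g U e"
begin

definition f :: "'a vfield" where "f = (\<lambda>q. \<phi> q (e q))"

lemma open_U: "open U" using basis by (simp add: phi_basis_def)

lemma frame_smooth: "smooth_vfield A U \<xi>" "smooth_vfield A U e" "smooth_vfield A U f"
  using basis reeb_smooth_on phi_smooth[OF open_U] by (auto simp: phi_basis_def f_def)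

lemma frame_tangent:
  assumes "q \<in> U"
  shows "\<xi> q \<in> tangent_space A q" "e q \<in> tangent_space A q" "f q \<in> tangent_space A q"
  using vfield_tangent[OF _ assms] frame_smooth by blast+

lemma frame_metric:
  assumes "q \<in> U"
  shows "g q (\<xi> q) (\<xi> q) = 1" "g q (e q) (e q) = 1" "g q (f q) (f q) = -1"
    "g q (\<xi> q) (e q) = 0" "g q (e q) (\<xi> q) = 0" "g q (\<xi> q) (f q) = 0" "g q (f q) (\<xi> q) = 0"
    "g q (e q) (f q) = 0" "g q (f q) (e q) = 0"
  using basis assms frame_tangent[OF assms] metric_sym[of _ q] by (auto simp: phi_basis_def f_def)

lemma frame_eta: "q \<in> U \<Longrightarrow> \<eta> q (\<xi> q) = 1" "q \<in> U \<Longrightarrow> \<eta> q (e q) = 0" "q \<in> U \<Longrightarrow> \<eta> q (f q) = 0"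
  using eta_metric frame_tangent frame_metric by auto

lemma phi_f: "q \<in> U \<Longrightarrow> \<phi> q (f q) = e q"
  using phi_phi[OF frame_tangent(2)] by (simp add: f_def frame_eta)

lemma metric_frame_combination:
  assumes "q \<in> U" and v: "v = x *\<^sub>R \<xi> q + y *\<^sub>R e q + z *\<^sub>R f q"
  shows "g q v (\<xi> q) = x" "g q v (e q) = y" "g q v (f q) = - z"
  unfolding v using frame_tangent[OF assms(1)] frame_metric[OF assms(1)] by (simp_all add: metric_simps)

text \<open>Spanning comes from the eigenlines. For \<open>w\<close> in the kernel of \<eta>, the
  vectors \<open>w + \<phi> w\<close> and \<open>w - \<phi> w\<close> lie in the eigenlines for 1
  and -1, which are spanned by \<open>e + f\<close> and \<open>e - f\<close>. Half their sum is
  \<open>w\<close>, and pairing with the frame identifies the coefficients.\<close>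

lemma frame_expansion:
  assumes q: "q \<in> U" and v: "v \<in> tangent_space A q"
  shows "v = g q v (\<xi> q) *\<^sub>R \<xi> q + g q v (e q) *\<^sub>R e q + (- g q v (f q)) *\<^sub>R f q"
proof -
  note t = frame_tangent[OF q]
  define w where "w = v - \<eta> q v *\<^sub>R \<xi> q"
  have w: "w \<in> tangent_space A q" unfolding w_def by (intro tangent_diff tangent_scaleR v t)
  have ew: "\<eta> q w = 0"
    unfolding eta_metric[OF w] unfolding w_def eta_metric[OF v]
    using v t frame_metric[OF q] by (simp add: metric_simps)
  have eta_sum: "\<eta> q (u + c *\<^sub>R u') = 0"
    if "u \<in> tangent_space A q" "u' \<in> tangent_space A q" "\<eta> q u = 0" "\<eta> q u' = 0" for u u' c
    using that t(1) eta_metric[of "u + c *\<^sub>R u'" q] by (simp add: eta_metric metric_simps)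
  have phi_sum: "\<phi> q (u + c *\<^sub>R u') = \<phi> q u + c *\<^sub>R \<phi> q u'"
    if "u \<in> tangent_space A q" "u' \<in> tangent_space A q" for u u' c
    using that by (simp add: phi_add phi_scaleR tangent_scaleR)
  \<comment> \<open>The factors 1 and -1 are kept explicit so that \<open>phi_sum\<close> and
    \<open>eta_sum\<close> cover both signs.\<close>
  have plus: "u + 1 *\<^sub>R \<phi> q u \<in> {v \<in> tangent_space A q. \<eta> q v = 0 \<and> \<phi> q v = v}"
    and minus: "u + (-1) *\<^sub>R \<phi> q u \<in> {v \<in> tangent_space A q. \<eta> q v = 0 \<and> \<phi> q v = - v}"
    if u: "u \<in> tangent_space A q" "\<eta> q u = 0" for u
  proof -
    have "\<phi> q (\<phi> q u) = u" by (simp add: phi_phi[OF u(1)] u(2))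
    then have "\<phi> q (u + 1 *\<^sub>R \<phi> q u) = u + 1 *\<^sub>R \<phi> q u"
      "\<phi> q (u + (-1) *\<^sub>R \<phi> q u) = - (u + (-1) *\<^sub>R \<phi> q u)"
      unfolding phi_sum[OF u(1) phi_tangent[OF u(1)]] by simp_all
    moreover have "\<eta> q (u + c *\<^sub>R \<phi> q u) = 0" "u + c *\<^sub>R \<phi> q u \<in> tangent_space A q" for c
      using eta_sum[OF u(1) phi_tangent[OF u(1)] u(2) eta_phi[OF u(1)]]
        tangent_add[OF u(1) tangent_scaleR[OF phi_tangent[OF u(1)]]] by auto
    ultimately show "u + 1 *\<^sub>R \<phi> q u \<in> {v \<in> tangent_space A q. \<eta> q v = 0 \<and> \<phi> q v = v}"
      "u + (-1) *\<^sub>R \<phi> q u \<in> {v \<in> tangent_space A q. \<eta> q v = 0 \<and> \<phi> q v = - v}"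
      by blast+
  qed
  have nz: "e q + c *\<^sub>R f q \<noteq> 0" for c
  proof
    assume "e q + c *\<^sub>R f q = 0"
    then have "g q (0 *\<^sub>R e q) (e q) = g q (e q + c *\<^sub>R f q) (e q)" by simp
    then show False
      using t frame_metric[OF q] by (simp only: metric_simps)
  qed
  have line: "\<exists>c. x = c *\<^sub>R y" if S: "dim S = 1" "x \<in> S" "y \<in> S" "y \<noteq> 0"
    for S :: "'a tvec set" and x y
  proof -
    obtain b where b: "\<And>x. x \<in> S \<Longrightarrow> \<exists>c. x = c *\<^sub>R b" using dim_1_multiple[OF S(1)] by metis
    obtain c d where c: "x = c *\<^sub>R b" and d: "y = d *\<^sub>R b" using b S(2,3) by blast
    have "d \<noteq> 0" using d S(4) by auto
    then have "x = (c / d) *\<^sub>R y" unfolding c d by simp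
    then show ?thesis by blast
  qed
  have e0: "e q \<in> tangent_space A q" "\<eta> q (e q) = 0" using t frame_eta q by auto
  obtain c where c: "w + 1 *\<^sub>R \<phi> q w = c *\<^sub>R (e q + 1 *\<^sub>R f q)"
    using line[OF dim_eigenspaces(1) plus[OF w ew] plus[OF e0]] nz[of 1] by (auto simp: f_def)
  obtain d where d: "w + (-1) *\<^sub>R \<phi> q w = d *\<^sub>R (e q + (-1) *\<^sub>R f q)"
    using line[OF dim_eigenspaces(2) minus[OF w ew] minus[OF e0]] nz[of "-1"] by (auto simp: f_def)
  have "2 *\<^sub>R w = (w + 1 *\<^sub>R \<phi> q w) + (w + (-1) *\<^sub>R \<phi> q w)" by (simp add: scaleR_2)
  also have "\<dots> = (c + d) *\<^sub>R e q + (c - d) *\<^sub>R f q"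
    unfolding c d by (simp add: algebra_simps)
  finally have "(1/2) *\<^sub>R (2 *\<^sub>R w) = (1/2) *\<^sub>R ((c + d) *\<^sub>R e q + (c - d) *\<^sub>R f q)" by simp
  then have "w = ((c + d) / 2) *\<^sub>R e q + ((c - d) / 2) *\<^sub>R f q"
    by (simp add: scaleR_add_right)
  then have exp: "v = \<eta> q v *\<^sub>R \<xi> q + ((c + d) / 2) *\<^sub>R e q + ((c - d) / 2) *\<^sub>R f q"
    unfolding w_def by (simp add: algebra_simps)
  show ?thesis
    unfolding metric_frame_combination[OF q exp] minus_minus by (rule exp)
qed

lemma frame_independent:
  assumes "q \<in> U" "x *\<^sub>R \<xi> q + y *\<^sub>R e q + z *\<^sub>R f q = 0"
  shows "x = 0" "y = 0" "z = 0"
  using metric_frame_combination[OF assms(1) assms(2)[symmetric]]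
    metric_scaleR_left[of "0" q _ 0] frame_tangent[OF assms(1)] tangent_0 by auto

section \<open>The \<phi>-basis as an indexed frame and its structure functions\<close>

definition E :: "3 \<Rightarrow> 'a vfield" where "E i = (if i = 1 then \<xi> else if i = 2 then e else f)"
definition sg :: "3 \<Rightarrow> real" where "sg i = (if i = 3 then -1 else 1)"

lemma E_simps: "E 1 = \<xi>" "E 2 = e" "E 3 = f" "sg 1 = 1" "sg 2 = 1" "sg 3 = -1"
  by (simp_all add: E_def sg_def)

lemma pseudo_orthonormal: "pseudo_orthonormal_frame A g U E sg"
  unfolding pseudo_orthonormal_frame_def
  using open_U frame_smooth by (auto simp: forall_3 E_simps frame_metric)

lemma E_expansion:
  "q \<in> U \<Longrightarrow> v \<in> tangent_space A q \<Longrightarrow> v = (\<Sum>j\<in>UNIV. (sg j * g q v (E j q)) *\<^sub>R E j q)"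
  using frame_expansion by (simp add: sum_3 E_simps)

definition trace :: "'a \<Rightarrow> 'a tvec" where
  "trace p = lie_deriv_connection A nabla \<xi> \<xi> \<xi> p + lie_deriv_connection A nabla \<xi> e e p -
    lie_deriv_connection A nabla \<xi> f f p"

lemma trace_any_frame:
  assumes "pseudo_orthonormal_frame A g U' F s" "p \<in> U" "p \<in> U'"
  shows "(\<Sum>i\<in>UNIV. s i *\<^sub>R lie_deriv_connection A nabla \<xi> (F i) (F i) p) = trace p"
  using trace_frame_independent[OF reeb_smooth pseudo_orthonormal assms(1-3) E_expansion]
  by (simp add: sum_3 E_simps trace_def)

text \<open>As \<open>f\<close> is time-like, the \<open>f\<close>-coefficient of a vector
  \<open>v\<close> is \<open>- g v f\<close>. Hence the minus signs in \<beta> and \<delta>;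
  \<open>a5\<close> has none because it is the negative of such a coefficient.\<close>

definition \<alpha> :: "'a \<Rightarrow> real" where "\<alpha> q = g q (lie_bracket A \<xi> e q) (e q)"
definition \<beta> :: "'a \<Rightarrow> real" where "\<beta> q = - g q (lie_bracket A \<xi> e q) (f q)"
definition \<gamma> :: "'a \<Rightarrow> real" where "\<gamma> q = g q (lie_bracket A \<xi> f q) (e q)"
definition \<delta> :: "'a \<Rightarrow> real" where "\<delta> q = - g q (lie_bracket A \<xi> f q) (f q)"
definition a4 :: "'a \<Rightarrow> real" where "a4 q = g q (lie_bracket A e f q) (e q)"
definition a5 :: "'a \<Rightarrow> real" where "a5 q = g q (lie_bracket A e f q) (f q)"

lemma structure_smooth:
  "smooth_fun A U \<alpha>" "smooth_fun A U \<beta>" "smooth_fun A U \<gamma>" "smooth_fun A U \<delta>"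
  "smooth_fun A U a4" "smooth_fun A U a5"
  unfolding \<alpha>_def[abs_def] \<beta>_def[abs_def] \<gamma>_def[abs_def] \<delta>_def[abs_def] a4_def[abs_def] a5_def[abs_def]
  by (intro smooth_fun_uminus metric_smooth lie_bracket_smooth open_U frame_smooth)+

text \<open>By \<open>eta_lie_bracket\<close> the \<xi>-components are
  \<open>-2 g \<xi> f = 0\<close>, \<open>-2 g \<xi> e = 0\<close> and \<open>-2 g e e = -2\<close>,
  because \<open>\<phi> e = f\<close> and \<open>\<phi> f = e\<close>.\<close>

lemma
  assumes q: "q \<in> U"
  shows bracket_reeb_e: "lie_bracket A \<xi> e q = \<alpha> q *\<^sub>R e q + \<beta> q *\<^sub>R f q"
    and bracket_reeb_f: "lie_bracket A \<xi> f q = \<gamma> q *\<^sub>R e q + \<delta> q *\<^sub>R f q"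
    and bracket_e_f: "lie_bracket A e f q = (-2) *\<^sub>R \<xi> q + a4 q *\<^sub>R e q + (- a5 q) *\<^sub>R f q"
proof -
  have t: "lie_bracket A X Y q \<in> tangent_space A q"
    if "smooth_vfield A U X" "smooth_vfield A U Y" for X Y
    using vfield_tangent[OF lie_bracket_smooth[OF open_U that] q] .
  have s: "g q (lie_bracket A X Y q) (\<xi> q) = g q (\<xi> q) (lie_bracket A X Y q)"
    if "smooth_vfield A U X" "smooth_vfield A U Y" for X Y
    using metric_sym[OF t[OF that] frame_tangent(1)[OF q]] .
  have "g q (\<xi> q) (lie_bracket A \<xi> e q) = 0"
    using eta_lie_bracket[OF open_U q frame_smooth(1,2) frame_eta(1,2)] frame_metric[OF q]
    by (simp add: f_def)
  then show "lie_bracket A \<xi> e q = \<alpha> q *\<^sub>R e q + \<beta> q *\<^sub>R f q"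
    using frame_expansion[OF q t[OF frame_smooth(1,2)]] s[OF frame_smooth(1,2)]
    by (simp add: \<alpha>_def \<beta>_def)
  have "g q (\<xi> q) (lie_bracket A \<xi> f q) = 0"
    using eta_lie_bracket[OF open_U q frame_smooth(1,3) frame_eta(1,3)] frame_metric[OF q]
    by (simp add: phi_f q)
  then show "lie_bracket A \<xi> f q = \<gamma> q *\<^sub>R e q + \<delta> q *\<^sub>R f q"
    using frame_expansion[OF q t[OF frame_smooth(1,3)]] s[OF frame_smooth(1,3)]
    by (simp add: \<gamma>_def \<delta>_def)
  have "g q (\<xi> q) (lie_bracket A e f q) = -2"
    using eta_lie_bracket[OF open_U q frame_smooth(2,3) frame_eta(2,3)] frame_metric[OF q]
    by (simp add: phi_f q)
  then show "lie_bracket A e f q = (-2) *\<^sub>R \<xi> q + a4 q *\<^sub>R e q + (- a5 q) *\<^sub>R f q"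
    using frame_expansion[OF q t[OF frame_smooth(2,3)]] s[OF frame_smooth(2,3)]
    by (simp add: a4_def a5_def)
qed

end

section \<open>Rules for linear combinations of fields, and Koszul's formula\<close>

lemma (in smooth_manifold) tangent_fun_uminus:
  assumes "v \<in> tangent_space A p" "open W" "p \<in> W" "smooth_fun A W h"
  shows "v (\<lambda>q. - h q) = - v h"
  using tangent_fun_diff[OF assms(1-3) smooth_fun_const[OF assms(2), of 0] assms(4)]
  by (simp add: tangent_const[OF assms(1)])

lemma (in smooth_manifold) tangent_fun_cmult:
  assumes "v \<in> tangent_space A p" "open W" "p \<in> W" "smooth_fun A W h"
  shows "v (\<lambda>q. c * h q) = c * v h"
  using tangent_fun_mult[OF assms(1-3) smooth_fun_const[OF assms(2), of c] assms(4)]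
  by (simp add: tangent_const[OF assms(1)])

lemma (in smooth_manifold) lie_bracket_self: "lie_bracket A X X p = 0"
  by (rule ext) (simp add: lie_bracket_def)

context smooth_manifold
begin

context
  fixes U p X Y Z and a b :: "'a \<Rightarrow> real"
  assumes U: "open U" "p \<in> U" and X: "smooth_vfield A U X" and Y: "smooth_vfield A U Y"
    and Z: "smooth_vfield A U Z" and a: "smooth_fun A U a" and b: "smooth_fun A U b"
begin

lemma lie_bracket_combination_left:
  "lie_bracket A (\<lambda>q. a q *\<^sub>R X q + b q *\<^sub>R Y q) Z p =
    a p *\<^sub>R lie_bracket A X Z p - Z p a *\<^sub>R X p + (b p *\<^sub>R lie_bracket A Y Z p - Z p b *\<^sub>R Y p)"
  unfolding lie_bracket_add_left[OF U smooth_vfield_scaleR[OF a X] Z smooth_vfield_scaleR[OF b Y]]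
    lie_bracket_scaleR_left[OF U a X Z] lie_bracket_scaleR_left[OF U b Y Z] ..

lemma lie_bracket_combination_right:
  "lie_bracket A Z (\<lambda>q. a q *\<^sub>R X q + b q *\<^sub>R Y q) p =
    a p *\<^sub>R lie_bracket A Z X p + Z p a *\<^sub>R X p + (b p *\<^sub>R lie_bracket A Z Y p + Z p b *\<^sub>R Y p)"
  unfolding lie_bracket_add_right[OF U Z smooth_vfield_scaleR[OF a X] smooth_vfield_scaleR[OF b Y]]
    lie_bracket_scaleR_right[OF U a Z X] lie_bracket_scaleR_right[OF U b Z Y] ..

end

end

context levi_civita_manifold
begin

text \<open>Constant inner products remove the three derivative terms of Koszul's formula, so the
  brackets alone determine the connection coefficients of a frame. The proof combines metric
  compatibility along \<open>X\<close>, \<open>Y\<close> and \<open>Z\<close>.\<close>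

lemma koszul_const:
  assumes U: "open U" "p \<in> U" and X: "smooth_vfield A U X" and Y: "smooth_vfield A U Y"
    and Z: "smooth_vfield A U Z"
    and XY: "\<And>q. q \<in> U \<Longrightarrow> g q (X q) (Y q) = k1" and XZ: "\<And>q. q \<in> U \<Longrightarrow> g q (X q) (Z q) = k2"
    and YZ: "\<And>q. q \<in> U \<Longrightarrow> g q (Y q) (Z q) = k3"
  shows "2 * g p (nabla X Y p) (Z p) = g p (lie_bracket A X Y p) (Z p) -
    g p (lie_bracket A X Z p) (Y p) - g p (lie_bracket A Y Z p) (X p)"
proof -
  have t: "V p \<in> tangent_space A p" if "smooth_vfield A U V" for V
    using vfield_tangent[OF that U(2)] .
  have c: "g p (nabla V V' p) (V'' p) + g p (V' p) (nabla V V'' p) = 0"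
    if V: "smooth_vfield A U V" "smooth_vfield A U V'" "smooth_vfield A U V''"
      and k: "\<And>q. q \<in> U \<Longrightarrow> g q (V' q) (V'' q) = k" for V V' V'' k
  proof -
    have "V p (\<lambda>q. g q (V' q) (V'' q)) = V p (\<lambda>q. k)"
      by (rule tangent_cong[OF t[OF V(1)] U]) (rule k)
    then show ?thesis using nabla_metric[OF U V] tangent_const[OF t[OF V(1)]] by simp
  qed
  have b: "g p (lie_bracket A V V' p) (V'' p) = g p (nabla V V' p) (V'' p) - g p (nabla V' V p) (V'' p)"
    if V: "smooth_vfield A U V" "smooth_vfield A U V'" "smooth_vfield A U V''" for V V' V''
    unfolding nabla_torsion[OF U V(1,2), symmetric]
    using metric_diff_left t nabla_smooth[OF U(1)] V by blast
  have s: "g p (V p) (nabla V' V'' p) = g p (nabla V' V'' p) (V p)"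
    if "smooth_vfield A U V" "smooth_vfield A U V'" "smooth_vfield A U V''" for V V' V''
    using metric_sym t nabla_smooth[OF U(1)] that by blast
  show ?thesis
    using c[OF X Y Z YZ] c[OF Y X Z XZ] c[OF Z X Y XY]
    unfolding b[OF X Y Z] b[OF X Z Y] b[OF Y Z X] s[OF X Y Z] s[OF X Z Y] s[OF Y X Z] s[OF Y Z X]
    by (simp add: s[OF X Z Y] s[OF Y X Z] s[OF X Y Z])
qed

context
  fixes U p X Y Z and a b :: "'a \<Rightarrow> real"
  assumes U: "open U" "p \<in> U" and X: "smooth_vfield A U X" and Y: "smooth_vfield A U Y"
    and Z: "smooth_vfield A U Z" and a: "smooth_fun A U a" and b: "smooth_fun A U b"
begin

lemma nabla_combination_left:
  "nabla (\<lambda>q. a q *\<^sub>R X q + b q *\<^sub>R Y q) Z p = a p *\<^sub>R nabla X Z p + b p *\<^sub>R nabla Y Z p"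
  unfolding nabla_add_left[OF U smooth_vfield_scaleR[OF a X] smooth_vfield_scaleR[OF b Y] Z]
    nabla_scaleR_left[OF U a X Z] nabla_scaleR_left[OF U b Y Z] ..

lemma nabla_combination_right:
  "nabla Z (\<lambda>q. a q *\<^sub>R X q + b q *\<^sub>R Y q) p =
    Z p a *\<^sub>R X p + a p *\<^sub>R nabla Z X p + (Z p b *\<^sub>R Y p + b p *\<^sub>R nabla Z Y p)"
  unfolding nabla_add_right[OF U Z smooth_vfield_scaleR[OF a X] smooth_vfield_scaleR[OF b Y]]
    nabla_scaleR_right[OF U a Z X] nabla_scaleR_right[OF U b Z Y] ..

end

end

section \<open>Jacobi identity and connection coefficients in a \<phi>-basis\<close>

context phi_frame
begin

lemma brackets_swapped:
  assumes "q \<in> U"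
  shows "lie_bracket A e \<xi> q = (- \<alpha> q) *\<^sub>R e q + (- \<beta> q) *\<^sub>R f q"
    "lie_bracket A f \<xi> q = (- \<gamma> q) *\<^sub>R e q + (- \<delta> q) *\<^sub>R f q"
    "lie_bracket A f e q = 2 *\<^sub>R \<xi> q + (- a4 q) *\<^sub>R e q + a5 q *\<^sub>R f q"
  using assms lie_bracket_antisym[of e \<xi> q] lie_bracket_antisym[of f \<xi> q] lie_bracket_antisym[of f e q]
  by (simp_all add: bracket_reeb_e bracket_reeb_f bracket_e_f)

lemmas brackets = bracket_reeb_e bracket_reeb_f bracket_e_f brackets_swapped

text \<open>These are the coefficients of \<xi>, \<open>e\<close> and \<open>f\<close> in the Jacobi
  identity for the frame. The first is \<open>-2 (\<alpha> + \<delta>)\<close>, because among the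
  frame brackets only \<open>[e, f]\<close> has a \<xi>-component.\<close>

lemma jacobi_identity:
  assumes p: "p \<in> U"
  shows "\<delta> p = - \<alpha> p"
    and "\<alpha> p * a4 p - f p \<alpha> - a4 p * \<alpha> p - \<xi> p a4 + a5 p * \<gamma> p + e p \<gamma> + \<delta> p * a4 p = 0"
    and "- \<alpha> p * a5 p - f p \<beta> - a4 p * \<beta> p + a5 p * \<delta> p + \<xi> p a5 + e p \<delta> - \<delta> p * a5 p = 0"
proof -
  note s = frame_smooth structure_smooth
  note sm = smooth_fun_uminus[OF open_U] smooth_fun_const[OF open_U] smooth_vfield_scaleR
  note br = lie_bracket_smooth[OF open_U]
  have c: "lie_bracket A X Z p = lie_bracket A X' Z p"
    if "\<And>q. q \<in> U \<Longrightarrow> X q = X' q" "smooth_vfield A U X" "smooth_vfield A U Z" for X X' Z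
    by (rule lie_bracket_cong[where X = X and X' = X' and Y = Z and Y' = Z, OF open_U p that(1) refl
          vfield_tangent[OF that(2) p] vfield_tangent[OF that(3) p]])
  \<comment> \<open>The inner bracket is replaced by its frame expression on all of
    \<open>U\<close>, since the outer bracket differentiates the coefficients.\<close>
  have c1: "lie_bracket A (lie_bracket A \<xi> e) f p =
      lie_bracket A (\<lambda>q. \<alpha> q *\<^sub>R e q + \<beta> q *\<^sub>R f q) f p"
    by (rule c[OF _ br[OF s(1,2)] s(3)]) (rule bracket_reeb_e)
  have 1: "lie_bracket A (lie_bracket A \<xi> e) f p =
      \<alpha> p *\<^sub>R lie_bracket A e f p - f p \<alpha> *\<^sub>R e p - f p \<beta> *\<^sub>R f p"
    unfolding c1
      lie_bracket_combination_left[OF open_U p s(2,3,3) s(4,5)]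
    by (simp add: lie_bracket_self)
  have c2: "lie_bracket A (lie_bracket A e f) \<xi> p =
      lie_bracket A (\<lambda>q. (-2) *\<^sub>R \<xi> q + a4 q *\<^sub>R e q + (- a5 q) *\<^sub>R f q) \<xi> p"
    by (rule c[OF _ br[OF s(2,3)] s(1)]) (rule bracket_e_f)
  have 2: "lie_bracket A (lie_bracket A e f) \<xi> p =
      a4 p *\<^sub>R lie_bracket A e \<xi> p - \<xi> p a4 *\<^sub>R e p - a5 p *\<^sub>R lie_bracket A f \<xi> p + \<xi> p a5 *\<^sub>R f p"
    unfolding c2
      lie_bracket_add_left[OF open_U p
        smooth_vfield_add[OF sm(3)[OF sm(2)[of "-2"] s(1)] sm(3)[OF s(8) s(2)]] s(1)
        sm(3)[OF sm(1)[OF s(9)] s(3)]]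
      lie_bracket_combination_left[OF open_U p s(1,2,1) sm(2)[of "-2"] s(8)]
      lie_bracket_scaleR_left[OF open_U p sm(1)[OF s(9)] s(3) s(1)]
      tangent_fun_uminus[OF frame_tangent(1)[OF p] open_U p s(9)]
      tangent_const[OF frame_tangent(1)[OF p]]
    by (simp add: lie_bracket_self)
  have c3: "lie_bracket A (lie_bracket A f \<xi>) e p =
      lie_bracket A (\<lambda>q. (- \<gamma> q) *\<^sub>R e q + (- \<delta> q) *\<^sub>R f q) e p"
    by (rule c[OF _ br[OF s(3,1)] s(2)]) (rule brackets_swapped(2))
  have 3: "lie_bracket A (lie_bracket A f \<xi>) e p =
      e p \<gamma> *\<^sub>R e p - \<delta> p *\<^sub>R lie_bracket A f e p + e p \<delta> *\<^sub>R f p"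
    unfolding c3
      lie_bracket_combination_left[OF open_U p s(2,3,2) sm(1)[OF s(6)] sm(1)[OF s(7)]]
      tangent_fun_uminus[OF frame_tangent(2)[OF p] open_U p s(6)]
      tangent_fun_uminus[OF frame_tangent(2)[OF p] open_U p s(7)]
    by (simp add: lie_bracket_self)
  have "(- 2 * \<alpha> p - 2 * \<delta> p) *\<^sub>R \<xi> p +
      (\<alpha> p * a4 p - f p \<alpha> - a4 p * \<alpha> p - \<xi> p a4 + a5 p * \<gamma> p + e p \<gamma> + \<delta> p * a4 p) *\<^sub>R e p +
      (- \<alpha> p * a5 p - f p \<beta> - a4 p * \<beta> p + a5 p * \<delta> p + \<xi> p a5 + e p \<delta> - \<delta> p * a5 p) *\<^sub>R f p =
      lie_bracket A (lie_bracket A \<xi> e) f p + lie_bracket A (lie_bracket A e f) \<xi> p +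
      lie_bracket A (lie_bracket A f \<xi>) e p"
    unfolding 1 2 3 brackets[OF p] by (simp add: algebra_simps)
  also have "\<dots> = 0" by (rule lie_bracket_jacobi[OF open_U p s(1-3)])
  finally have "- 2 * \<alpha> p - 2 * \<delta> p = 0"
    and 4: "\<alpha> p * a4 p - f p \<alpha> - a4 p * \<alpha> p - \<xi> p a4 + a5 p * \<gamma> p + e p \<gamma> + \<delta> p * a4 p = 0"
      "- \<alpha> p * a5 p - f p \<beta> - a4 p * \<beta> p + a5 p * \<delta> p + \<xi> p a5 + e p \<delta> - \<delta> p * a5 p = 0"
    using frame_independent[OF p] by blast+
  then show "\<delta> p = - \<alpha> p" by simp
  show "\<alpha> p * a4 p - f p \<alpha> - a4 p * \<alpha> p - \<xi> p a4 + a5 p * \<gamma> p + e p \<gamma> + \<delta> p * a4 p = 0"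
    "- \<alpha> p * a5 p - f p \<beta> - a4 p * \<beta> p + a5 p * \<delta> p + \<xi> p a5 + e p \<delta> - \<delta> p * a5 p = 0"
    by (fact 4)+
qed

text \<open>Exactly these covariant derivatives enter the trace: as \<open>[\<xi>, e]\<close> and
  \<open>[\<xi>, f]\<close> have no \<xi>-component, neither \<open>e\<close> nor \<open>f\<close>
  is ever differentiated along \<xi>.\<close>

lemma nabla_frame:
  assumes q: "q \<in> U"
  shows "nabla \<xi> \<xi> q = 0"
    and "nabla e e q = \<alpha> q *\<^sub>R \<xi> q + a4 q *\<^sub>R f q"
    and "nabla f f q = (- \<delta> q) *\<^sub>R \<xi> q + a5 q *\<^sub>R e q"
    and "nabla e f q = ((\<gamma> q - \<beta> q) / 2 - 1) *\<^sub>R \<xi> q + a4 q *\<^sub>R e q"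
    and "nabla f e q = ((\<gamma> q - \<beta> q) / 2 + 1) *\<^sub>R \<xi> q + a5 q *\<^sub>R f q"
proof -
  note s = frame_smooth and t = frame_tangent[OF q] and m = frame_metric[OF q]
  have exp: "nabla X Y q = g q (nabla X Y q) (\<xi> q) *\<^sub>R \<xi> q + g q (nabla X Y q) (e q) *\<^sub>R e q +
      (- g q (nabla X Y q) (f q)) *\<^sub>R f q"
    if "smooth_vfield A U X" "smooth_vfield A U Y" for X Y
    by (rule frame_expansion[OF q vfield_tangent[OF nabla_smooth[OF open_U that] q]])
  note K = koszul_const[OF open_U q]
  have Z: "g q 0 (X q) = 0" if "smooth_vfield A U X" for X
    using metric_scaleR_left[OF vfield_tangent[OF that q] vfield_tangent[OF that q], of 0] by simp
  note simps = lie_bracket_self brackets[OF q] metric_simps t m Z s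
  have "2 * g q (nabla \<xi> \<xi> q) (\<xi> q) = 0" "2 * g q (nabla \<xi> \<xi> q) (e q) = 0" "2 * g q (nabla \<xi> \<xi> q) (f q) = 0"
    using K[OF s(1,1,1) frame_metric(1,1,1)] K[OF s(1,1,2) frame_metric(1,4,4)]
      K[OF s(1,1,3) frame_metric(1,6,6)] by (simp_all add: simps)
  then show "nabla \<xi> \<xi> q = 0" by (subst exp[OF s(1,1)]) simp
  have "2 * g q (nabla e e q) (\<xi> q) = 2 * \<alpha> q" "2 * g q (nabla e e q) (e q) = 0"
    "2 * g q (nabla e e q) (f q) = - 2 * a4 q"
    using K[OF s(2,2,1) frame_metric(2,5,5)] K[OF s(2,2,2) frame_metric(2,2,2)]
      K[OF s(2,2,3) frame_metric(2,8,8)] by (simp_all add: simps)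
  then show "nabla e e q = \<alpha> q *\<^sub>R \<xi> q + a4 q *\<^sub>R f q" by (subst exp[OF s(2,2)]) simp
  have "2 * g q (nabla f f q) (\<xi> q) = - 2 * \<delta> q" "2 * g q (nabla f f q) (e q) = 2 * a5 q"
    "2 * g q (nabla f f q) (f q) = 0"
    using K[OF s(3,3,1) frame_metric(3,7,7)] K[OF s(3,3,2) frame_metric(3,9,9)]
      K[OF s(3,3,3) frame_metric(3,3,3)] by (simp_all add: simps)
  then show "nabla f f q = (- \<delta> q) *\<^sub>R \<xi> q + a5 q *\<^sub>R e q" by (subst exp[OF s(3,3)]) simp
  have "2 * g q (nabla e f q) (\<xi> q) = \<gamma> q - \<beta> q - 2" "2 * g q (nabla e f q) (e q) = 2 * a4 q"
    "2 * g q (nabla e f q) (f q) = 0"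
    using K[OF s(2,3,1) frame_metric(8,5,7)] K[OF s(2,3,2) frame_metric(8,2,9)]
      K[OF s(2,3,3) frame_metric(8,8,3)] by (simp_all add: simps)
  then have "g q (nabla e f q) (\<xi> q) = (\<gamma> q - \<beta> q) / 2 - 1" "g q (nabla e f q) (e q) = a4 q"
    "g q (nabla e f q) (f q) = 0" by (simp_all add: field_simps)
  then show ef: "nabla e f q = ((\<gamma> q - \<beta> q) / 2 - 1) *\<^sub>R \<xi> q + a4 q *\<^sub>R e q"
    by (subst exp[OF s(2,3)]) simp
  show "nabla f e q = ((\<gamma> q - \<beta> q) / 2 + 1) *\<^sub>R \<xi> q + a5 q *\<^sub>R f q"
    using nabla_torsion[OF open_U q s(3,2)] unfolding ef brackets[OF q]
    by (simp add: algebra_simps scaleR_2)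
qed

end

section \<open>The trace of the Lie derivative of the connection\<close>

context phi_frame
begin

lemma bracket_reeb_f': "q \<in> U \<Longrightarrow> lie_bracket A \<xi> f q = \<gamma> q *\<^sub>R e q + (- \<alpha> q) *\<^sub>R f q"
  using bracket_reeb_f jacobi_identity(1) by simp

lemma tangent_delta:
  assumes "p \<in> U" "v \<in> tangent_space A p"
  shows "v \<delta> = - v \<alpha>"
proof -
  have "v \<delta> = v (\<lambda>q. - \<alpha> q)"
    by (rule tangent_cong[OF assms(2) open_U assms(1)]) (rule jacobi_identity(1))
  then show ?thesis using tangent_fun_uminus[OF assms(2) open_U assms(1) structure_smooth(1)] by simp
qed

lemma
  assumes "p \<in> U"
  shows reeb_a4: "\<xi> p a4 = e p \<gamma> - f p \<alpha> + a5 p * \<gamma> p - \<alpha> p * a4 p"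
    and reeb_a5: "\<xi> p a5 = f p \<beta> + e p \<alpha> + a4 p * \<beta> p + \<alpha> p * a5 p"
  using jacobi_identity[OF assms] tangent_delta[OF assms frame_tangent(2)[OF assms]]
  by (simp_all add: algebra_simps)

text \<open>Half of the \<open>e\<close>-coefficient of the trace (\<open>Q\<close> is the same for
  \<open>f\<close>), after \<open>reeb_a4\<close> and \<open>reeb_a5\<close> have eliminated the
  derivatives of \<open>a4\<close> and \<open>a5\<close>.\<close>

definition P :: "'a \<Rightarrow> real" where
  "P q = (f q \<gamma> - f q \<beta>) / 2 - e q \<alpha> + a4 q * (\<gamma> q - \<beta> q) - 2 * \<alpha> q * a5 q"

definition Q :: "'a \<Rightarrow> real" where
  "Q q = (e q \<gamma> - e q \<beta>) / 2 - f q \<alpha> - 2 * \<alpha> q * a4 q + a5 q * (\<gamma> q - \<beta> q)"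

lemma trace_formula:
  assumes p: "p \<in> U"
  shows "trace p = ((\<gamma> p - \<beta> p)\<^sup>2 - 4 * (\<alpha> p)\<^sup>2) *\<^sub>R \<xi> p + (2 * P p) *\<^sub>R e p + (2 * Q p) *\<^sub>R f p"
proof -
  note s = frame_smooth structure_smooth
  note sv = smooth_vfield_scaleR smooth_vfield_add[OF smooth_vfield_scaleR smooth_vfield_scaleR]
  note un = smooth_fun_uminus[OF open_U]
  note co = smooth_fun_const[OF open_U]
  note t = frame_tangent[OF p]
  have lc: "lie_bracket A \<xi> Y p = lie_bracket A \<xi> Y' p"
    if "\<And>q. q \<in> U \<Longrightarrow> Y q = Y' q" "smooth_vfield A U Y" for Y Y'
    by (rule lie_bracket_cong[where X = \<xi> and X' = \<xi> and Y = Y and Y' = Y', OF open_U p refl that(1)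
          t(1) vfield_tangent[OF that(2) p]])
  have nl: "nabla X Z p = nabla X' Z p"
    if "\<And>q. q \<in> U \<Longrightarrow> X q = X' q" "smooth_vfield A U X" "smooth_vfield A U X'" "smooth_vfield A U Z" for X X' Z
    by (rule nabla_cong[where X = X and X' = X' and Y = Z and Y' = Z,
          OF open_U p that(2,3,4,4) that(1) refl])
  have nr: "nabla Z X p = nabla Z X' p"
    if "\<And>q. q \<in> U \<Longrightarrow> X q = X' q" "smooth_vfield A U X" "smooth_vfield A U X'" "smooth_vfield A U Z" for X X' Z
    by (rule nabla_cong[where X = Z and X' = Z and Y = X and Y' = X',
          OF open_U p that(4,4,2,3) refl that(1)])
  note br = lie_bracket_smooth[OF open_U] and na = nabla_smooth[OF open_U]
  \<comment> \<open>The zero field is written as 0 times \<xi>, the form to which the scaling rules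
    apply.\<close>
  have "lie_bracket A \<xi> (nabla \<xi> \<xi>) p = lie_bracket A \<xi> (\<lambda>q. 0 *\<^sub>R \<xi> q) p"
    by (rule lc[OF _ na[OF s(1,1)]]) (simp add: nabla_frame)
  also have "\<dots> = 0"
    using lie_bracket_scaleR_right[OF open_U p co[of 0] s(1,1)] tangent_const[OF t(1)] by simp
  finally have x1: "lie_bracket A \<xi> (nabla \<xi> \<xi>) p = 0" .
  have "nabla (lie_bracket A \<xi> \<xi>) \<xi> p = nabla (\<lambda>q. 0 *\<^sub>R \<xi> q) \<xi> p"
    by (rule nl[OF _ br[OF s(1,1)] sv(1)[OF co s(1)] s(1)]) (simp add: lie_bracket_self)
  also have "\<dots> = 0" using nabla_scaleR_left[OF open_U p co[of 0] s(1,1)] by simp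
  finally have x2: "nabla (lie_bracket A \<xi> \<xi>) \<xi> p = 0" .
  have "nabla \<xi> (lie_bracket A \<xi> \<xi>) p = nabla \<xi> (\<lambda>q. 0 *\<^sub>R \<xi> q) p"
    by (rule nr[OF _ br[OF s(1,1)] sv(1)[OF co s(1)] s(1)]) (simp add: lie_bracket_self)
  also have "\<dots> = 0"
    using nabla_scaleR_right[OF open_U p co[of 0] s(1,1)] tangent_const[OF t(1)] by simp
  finally have x3: "nabla \<xi> (lie_bracket A \<xi> \<xi>) p = 0" .

  have "lie_bracket A \<xi> (nabla e e) p = lie_bracket A \<xi> (\<lambda>q. \<alpha> q *\<^sub>R \<xi> q + a4 q *\<^sub>R f q) p"
    by (rule lc[OF _ na[OF s(2,2)]]) (rule nabla_frame)
  also note lie_bracket_combination_right[OF open_U p s(1,3,1) s(4,8)]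
  finally have e1: "lie_bracket A \<xi> (nabla e e) p =
      \<xi> p \<alpha> *\<^sub>R \<xi> p + (a4 p *\<^sub>R lie_bracket A \<xi> f p + \<xi> p a4 *\<^sub>R f p)"
    by (simp add: lie_bracket_self)
  have "nabla (lie_bracket A \<xi> e) e p = nabla (\<lambda>q. \<alpha> q *\<^sub>R e q + \<beta> q *\<^sub>R f q) e p"
    by (rule nl[OF _ br[OF s(1,2)] sv(2)[OF s(4,2,5,3)] s(2)]) (rule bracket_reeb_e)
  also note nabla_combination_left[OF open_U p s(2,3,2) s(4,5)]
  finally have e2: "nabla (lie_bracket A \<xi> e) e p = \<alpha> p *\<^sub>R nabla e e p + \<beta> p *\<^sub>R nabla f e p" .
  have "nabla e (lie_bracket A \<xi> e) p = nabla e (\<lambda>q. \<alpha> q *\<^sub>R e q + \<beta> q *\<^sub>R f q) p"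
    by (rule nr[OF _ br[OF s(1,2)] sv(2)[OF s(4,2,5,3)] s(2)]) (rule bracket_reeb_e)
  also note nabla_combination_right[OF open_U p s(2,3,2) s(4,5)]
  finally have e3: "nabla e (lie_bracket A \<xi> e) p =
      e p \<alpha> *\<^sub>R e p + \<alpha> p *\<^sub>R nabla e e p + (e p \<beta> *\<^sub>R f p + \<beta> p *\<^sub>R nabla e f p)" .

  \<comment> \<open>With \<open>\<delta> = - \<alpha>\<close> the \<xi>-components of
    \<open>\<nabla>_e e\<close> and \<open>\<nabla>_f f\<close> agree, so the derivative of \<alpha>
    along \<xi> cancels in the trace.\<close>
  have "lie_bracket A \<xi> (nabla f f) p = lie_bracket A \<xi> (\<lambda>q. \<alpha> q *\<^sub>R \<xi> q + a5 q *\<^sub>R e q) p"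
    by (rule lc[OF _ na[OF s(3,3)]]) (simp add: nabla_frame jacobi_identity(1))
  also note lie_bracket_combination_right[OF open_U p s(1,2,1) s(4,9)]
  finally have f1: "lie_bracket A \<xi> (nabla f f) p =
      \<xi> p \<alpha> *\<^sub>R \<xi> p + (a5 p *\<^sub>R lie_bracket A \<xi> e p + \<xi> p a5 *\<^sub>R e p)"
    by (simp add: lie_bracket_self)
  have "nabla (lie_bracket A \<xi> f) f p = nabla (\<lambda>q. \<gamma> q *\<^sub>R e q + (- \<alpha> q) *\<^sub>R f q) f p"
    by (rule nl[OF _ br[OF s(1,3)] sv(2)[OF s(6,2) un[OF s(4)] s(3)] s(3)]) (rule bracket_reeb_f')
  also note nabla_combination_left[OF open_U p s(2,3,3,6) un[OF s(4)]]
  finally have f2: "nabla (lie_bracket A \<xi> f) f p = \<gamma> p *\<^sub>R nabla e f p + (- \<alpha> p) *\<^sub>R nabla f f p" .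
  have "nabla f (lie_bracket A \<xi> f) p = nabla f (\<lambda>q. \<gamma> q *\<^sub>R e q + (- \<alpha> q) *\<^sub>R f q) p"
    by (rule nr[OF _ br[OF s(1,3)] sv(2)[OF s(6,2) un[OF s(4)] s(3)] s(3)]) (rule bracket_reeb_f')
  also note nabla_combination_right[OF open_U p s(2,3,3,6) un[OF s(4)]]
  finally have f3: "nabla f (lie_bracket A \<xi> f) p =
      f p \<gamma> *\<^sub>R e p + \<gamma> p *\<^sub>R nabla f e p + (- f p \<alpha> *\<^sub>R f p + (- \<alpha> p) *\<^sub>R nabla f f p)"
    unfolding tangent_fun_uminus[OF t(3) open_U p s(4)] .

  have P: "2 * P p = f p \<gamma> - f p \<beta> - 2 * e p \<alpha> + 2 * a4 p * (\<gamma> p - \<beta> p) - 4 * \<alpha> p * a5 p"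
    and Q: "2 * Q p = e p \<gamma> - e p \<beta> - 2 * f p \<alpha> - 4 * \<alpha> p * a4 p + 2 * a5 p * (\<gamma> p - \<beta> p)"
    by (simp_all add: P_def Q_def field_simps)
  \<comment> \<open>Writing \<gamma> as \<open>\<beta> + 2 k\<close> removes the halves. Evaluated
    at a function \<open>h\<close>, the claim is then a polynomial identity.\<close>
  define k where "k = (\<gamma> p - \<beta> p) / 2"
  have k: "\<gamma> p = \<beta> p + 2 * k" by (simp add: k_def field_simps)
  show ?thesis
  proof
    fix h
    show "trace p h = (((\<gamma> p - \<beta> p)\<^sup>2 - 4 * (\<alpha> p)\<^sup>2) *\<^sub>R \<xi> p + (2 * P p) *\<^sub>R e p + (2 * Q p) *\<^sub>R f p) h"
      unfolding trace_def lie_deriv_connection_def x1 x2 x3 e1 e2 e3 f1 f2 f3 nabla_frame[OF p]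
        bracket_reeb_e[OF p] bracket_reeb_f'[OF p] reeb_a4[OF p] reeb_a5[OF p] jacobi_identity(1)[OF p] P Q k
      by (simp add: scaleR_fun_def) algebra
  qed
qed

lemma frame_fun_smooth:
  assumes "smooth_fun A U h"
  shows "smooth_fun A U (\<lambda>q. \<xi> q h)" "smooth_fun A U (\<lambda>q. e q h)" "smooth_fun A U (\<lambda>q. f q h)"
  using vfield_fun[OF _ open_U _ assms] frame_smooth by auto

lemma P_smooth: "smooth_fun A U P" and Q_smooth: "smooth_fun A U Q"
proof -
  note s = structure_smooth and d = frame_fun_smooth
  note add = smooth_fun_add[OF open_U] and diff = smooth_fun_diff[OF open_U]
    and mult = smooth_fun_mult[OF open_U] and const = smooth_fun_const[OF open_U]
  have "smooth_fun A U (\<lambda>q. (1/2) * (f q \<gamma> - f q \<beta>) - e q \<alpha> + a4 q * (\<gamma> q - \<beta> q) - 2 * \<alpha> q * a5 q)"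
    by (rule diff[OF add[OF diff[OF mult[OF const diff[OF d(3)[OF s(3)] d(3)[OF s(2)]]] d(2)[OF s(1)]]
            mult[OF s(5) diff[OF s(3,2)]]] mult[OF mult[OF const s(1)] s(6)]])
  then show "smooth_fun A U P" by (rule smooth_fun_cong[OF open_U, rotated]) (simp add: P_def)
  have "smooth_fun A U (\<lambda>q. (1/2) * (e q \<gamma> - e q \<beta>) - f q \<alpha> - 2 * \<alpha> q * a4 q + a5 q * (\<gamma> q - \<beta> q))"
    by (rule add[OF diff[OF diff[OF mult[OF const diff[OF d(2)[OF s(3)] d(2)[OF s(2)]]] d(3)[OF s(1)]]
            mult[OF mult[OF const s(1)] s(5)]] mult[OF s(6) diff[OF s(3,2)]]])
  then show "smooth_fun A U Q" by (rule smooth_fun_cong[OF open_U, rotated]) (simp add: Q_def)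
qed

lemma trace_zero_iff:
  assumes "p \<in> U"
  shows "trace p = 0 \<longleftrightarrow> (\<gamma> p - \<beta> p)\<^sup>2 = 4 * (\<alpha> p)\<^sup>2 \<and> P p = 0 \<and> Q p = 0"
proof
  assume "trace p = 0"
  then show "(\<gamma> p - \<beta> p)\<^sup>2 = 4 * (\<alpha> p)\<^sup>2 \<and> P p = 0 \<and> Q p = 0"
    using frame_independent[OF assms trace_formula[OF assms, symmetric, THEN trans]] by simp
next
  assume "(\<gamma> p - \<beta> p)\<^sup>2 = 4 * (\<alpha> p)\<^sup>2 \<and> P p = 0 \<and> Q p = 0"
  then show "trace p = 0" unfolding trace_formula[OF assms] by simp
qed

end

section \<open>The local description\<close>

lemma (in smooth_manifold) smooth_zero_at_limit:
  assumes U: "open U" "q \<in> U" and h: "smooth_fun A U h"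
    and zero: "\<And>S. open S \<Longrightarrow> q \<in> S \<Longrightarrow> S \<subseteq> U \<Longrightarrow> \<exists>x\<in>S. h x = 0"
  shows "h q = 0"
proof (rule ccontr)
  assume "h q \<noteq> 0"
  then show False
    using zero[OF open_smooth_preimage[OF U(1) h, of "- {0}"]] U(2) by auto
qed

context phi_frame
begin

text \<open>The right-hand side of the theorem with the \<phi>-basis held fixed, so that both
  directions can be argued inside one frame.\<close>

definition described ::
  "('a \<Rightarrow> real) \<Rightarrow> ('a \<Rightarrow> real) \<Rightarrow> ('a \<Rightarrow> real) \<Rightarrow> ('a \<Rightarrow> real) \<Rightarrow> ('a \<Rightarrow> real) \<Rightarrow> bool" where
  "described \<epsilon> c1 c3 c4 c5 \<longleftrightarrow> local_sign U \<epsilon> \<and>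
     smooth_fun A U c1 \<and> smooth_fun A U c3 \<and> smooth_fun A U c4 \<and> smooth_fun A U c5 \<and>
     (\<forall>q\<in>U.
        lie_bracket A \<xi> e q = - (\<epsilon> q * c1 q) *\<^sub>R e q + (c3 q - c1 q + 1) *\<^sub>R f q \<and>
        lie_bracket A \<xi> f q = (c3 q + c1 q + 1) *\<^sub>R e q + (\<epsilon> q * c1 q) *\<^sub>R f q \<and>
        lie_bracket A e f q = - 2 *\<^sub>R \<xi> q + c4 q *\<^sub>R e q - c5 q *\<^sub>R f q \<and>
        \<xi> q c4 - e q c3 + \<epsilon> q * c1 q * c4 q - c5 q * (c3 q - c1 q + 1) = 0 \<and>
        \<xi> q c5 - f q c3 - \<epsilon> q * c1 q * c5 q - c4 q * (c3 q + c1 q + 1) = 0 \<and>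
        (e q + \<epsilon> q *\<^sub>R f q) c1 + 2 * \<epsilon> q * c1 q * c4 q + 2 * c1 q * c5 q = 0)"

lemma tangent_combination:
  assumes q: "q \<in> U" and v: "v \<in> tangent_space A q" and h: "smooth_fun A U h" and k: "smooth_fun A U k"
  shows "v (\<lambda>x. c * h x + d * k x + c') = c * v h + d * v k"
proof -
  note m = smooth_fun_mult[OF open_U smooth_fun_const[OF open_U]]
  show ?thesis
    unfolding tangent_fun_add[OF v open_U q smooth_fun_add[OF open_U m[OF h] m[OF k]]
        smooth_fun_const[OF open_U]]
      tangent_fun_add[OF v open_U q m[OF h] m[OF k]] tangent_fun_cmult[OF v open_U q h]
      tangent_fun_cmult[OF v open_U q k] tangent_const[OF v] by simp
qed

text \<open>Where \<open>v = (\<gamma> - \<beta>)/2 - \<alpha>\<close> vanishes on a neighbourhood, the sign is \<open>-1\<close>.  Every other point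
  is a limit of points with \<open>v \<noteq> 0\<close>; there \<open>u = (\<gamma> - \<beta>)/2 + \<alpha>\<close> vanishes because \<open>u v = 0\<close>, and so
  both \<open>u\<close> and its derivatives vanish at the limit point, which permits the sign \<open>1\<close>.\<close>

lemma described_if_trace_zero:
  assumes tr: "\<And>q. q \<in> U \<Longrightarrow> trace q = 0"
  shows "\<exists>\<epsilon> c1 c3 c4 c5. described \<epsilon> c1 c3 c4 c5"
proof -
  note s = structure_smooth
  \<comment> \<open>The coefficients solve \<open>\<gamma> = c3 + c1 + 1\<close> and
    \<open>\<beta> = c3 - c1 + 1\<close>, and the shape is the one that
    \<open>tangent_combination\<close> differentiates.\<close>
  define c1 where "c1 = (\<lambda>q. (1/2) * \<gamma> q + (-1/2) * \<beta> q + 0)"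
  define c3 where "c3 = (\<lambda>q. (1/2) * \<gamma> q + (1/2) * \<beta> q + (-1))"
  have c: "smooth_fun A U c1" "smooth_fun A U c3"
    unfolding c1_def c3_def
    by (rule smooth_fun_add[OF open_U smooth_fun_add[OF open_U
            smooth_fun_mult[OF open_U smooth_fun_const[OF open_U] s(3)]
            smooth_fun_mult[OF open_U smooth_fun_const[OF open_U] s(2)]]
          smooth_fun_const[OF open_U]])+
  have gb: "\<gamma> q = c3 q + c1 q + 1" "\<beta> q = c3 q - c1 q + 1" for q
    by (simp_all add: c1_def c3_def)
  have dc: "w c1 = (w \<gamma> - w \<beta>) / 2" "w c3 = (w \<gamma> + w \<beta>) / 2"
    if "q \<in> U" "w \<in> tangent_space A q" for q w
    unfolding c1_def c3_def tangent_combination[OF that s(3,2)] by simp_all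
  define u where "u = (\<lambda>q. c1 q + \<alpha> q)"
  define v where "v = (\<lambda>q. c1 q - \<alpha> q)"
  have su: "smooth_fun A U u" and sv: "smooth_fun A U v"
    unfolding u_def v_def by (rule smooth_fun_add[OF open_U c(1) s(1)] smooth_fun_diff[OF open_U c(1) s(1)])+
  \<comment> \<open>The \<xi>-coefficient of the trace is \<open>4 u v\<close>.\<close>
  have uv: "u q * v q = 0" if "q \<in> U" for q
    using tr[OF that] unfolding trace_zero_iff[OF that]
    by (simp add: u_def v_def c1_def field_simps power2_eq_square)
  \<comment> \<open>The interior is taken because \<open>v = 0\<close> can be differentiated only
    where it holds on a neighbourhood.\<close>
  define N where "N = interior {q \<in> U. v q = 0}"
  have N: "open N" "N \<subseteq> U" "\<And>q. q \<in> N \<Longrightarrow> v q = 0"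
    unfolding N_def using interior_subset by auto
  define V where "V = {q \<in> U. v q \<in> - {0}}"
  have V: "open V" "V \<subseteq> U" "\<And>q. q \<in> V \<Longrightarrow> v q \<noteq> 0"
    unfolding V_def using open_smooth_preimage[OF open_U sv, of "- {0}"] by auto
  have near_V: "\<exists>x\<in>S. x \<in> V" if S: "open S" "q \<in> S" "S \<subseteq> U" and q: "q \<notin> N" for S q
  proof (rule ccontr)
    assume "\<not> (\<exists>x\<in>S. x \<in> V)"
    then have "S \<subseteq> {q \<in> U. v q = 0}" using S by (auto simp: V_def)
    then have "q \<in> N" unfolding N_def using S by (meson interior_maximal subsetD)
    then show False using q by simp
  qed
  have u0: "u q = 0" if "q \<in> V" for q using uv V that by (metis mult_eq_0_iff subsetD)
  \<comment> \<open>On \<open>N\<close>, \<open>v = 0\<close> means \<open>\<alpha> = c1\<close>;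
    elsewhere in \<open>U\<close>, \<open>u = 0\<close> will give \<open>\<alpha> = - c1\<close>.
    Both read \<open>\<alpha> = - \<epsilon> c1\<close>.\<close>
  define \<epsilon> where "\<epsilon> = (\<lambda>q. if q \<in> N then - 1 else 1 :: real)"
  have eps: "\<epsilon> q * \<epsilon> q = 1" for q by (simp add: \<epsilon>_def)
  have sign: "local_sign U \<epsilon>"
    unfolding local_sign_def
  proof (intro conjI exI[of _ "N \<union> V"])
    show "\<forall>q\<in>U. \<epsilon> q \<in> {1, - 1}" by (simp add: \<epsilon>_def)
    show "open (N \<union> V)" "N \<union> V \<subseteq> U" using N V by auto
    show "U \<subseteq> closure (N \<union> V)"
    proof
      fix q assume q: "q \<in> U"
      show "q \<in> closure (N \<union> V)"
      proof (rule ccontr)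
        assume c: "q \<notin> closure (N \<union> V)"
        then have "q \<notin> N" using closure_subset[of "N \<union> V"] by blast
        then have "\<exists>x\<in>U - closure (N \<union> V). x \<in> V"
          by (intro near_V[OF open_Diff[OF open_U closed_closure]]) (use c q in simp_all)
        then show False using closure_subset[of "N \<union> V"] by blast
      qed
    qed
    show "\<forall>q\<in>N \<union> V. \<exists>S. open S \<and> q \<in> S \<and> S \<subseteq> N \<union> V \<and> (\<forall>x\<in>S. \<epsilon> x = \<epsilon> q)"
    proof
      fix q assume "q \<in> N \<union> V"
      then show "\<exists>S. open S \<and> q \<in> S \<and> S \<subseteq> N \<union> V \<and> (\<forall>x\<in>S. \<epsilon> x = \<epsilon> q)"
      proof
        assume "q \<in> N"
        then show ?thesis using N by (intro exI[of _ N]) (auto simp: \<epsilon>_def)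
      next
        assume "q \<in> V"
        then show ?thesis using V N by (intro exI[of _ V]) (auto simp: \<epsilon>_def)
      qed
    qed
  qed
  \<comment> \<open>The sign may jump at \<open>q\<close>, yet the first derivatives along
    \<open>e\<close> and \<open>f\<close> come out as if it were constant.\<close>
  have al: "\<alpha> q = - (\<epsilon> q * c1 q) \<and> e q \<alpha> = - \<epsilon> q * e q c1 \<and> f q \<alpha> = - \<epsilon> q * f q c1" if q: "q \<in> U" for q
  proof (cases "q \<in> N")
    case True
    have "w v = 0" if "w \<in> tangent_space A q" for w
      using tangent_cong[OF that N(1) True N(3)] tangent_const[OF that] by simp
    moreover have "w v = w c1 - w \<alpha>" if "w \<in> tangent_space A q" for w
      unfolding v_def by (rule tangent_fun_diff[OF that open_U q c(1) s(1)])
    ultimately have "w \<alpha> = w c1" if "w \<in> tangent_space A q" for w using that by fastforce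
    then show ?thesis using N(3)[OF True] frame_tangent[OF q] True by (simp add: \<epsilon>_def v_def)
  next
    case False
    have lim: "h q = 0" if "smooth_fun A U h" "\<And>x. x \<in> V \<Longrightarrow> h x = 0" for h
      using smooth_zero_at_limit[OF open_U q that(1)] near_V False that(2) by metis
    have "w u = 0" if "x \<in> V" "w \<in> tangent_space A x" for x w
      using tangent_cong[OF that(2) V(1) that(1) u0] tangent_const[OF that(2)] by simp
    then have 0: "u q = 0" "e q u = 0" "f q u = 0"
      using lim[OF su u0] lim[OF frame_fun_smooth(2)[OF su]] lim[OF frame_fun_smooth(3)[OF su]]
        frame_tangent V(2) by blast+
    have "w u = w c1 + w \<alpha>" if "w \<in> tangent_space A q" for w
      unfolding u_def by (rule tangent_fun_add[OF that open_U q c(1) s(1)])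
    from this[OF frame_tangent(2)[OF q]] this[OF frame_tangent(3)[OF q]] 0
    have "e q \<alpha> = - e q c1" "f q \<alpha> = - f q c1" "\<alpha> q = - c1 q" by (simp_all add: u_def)
    then show ?thesis using False by (simp add: \<epsilon>_def)
  qed
  have "described \<epsilon> c1 c3 a4 a5"
    unfolding described_def
  proof (intro conjI ballI sign c s(5,6))
    fix q assume q: "q \<in> U"
    note t = frame_tangent[OF q]
    note d = dc[OF q t(2)] dc[OF q t(3)]
    have al: "\<alpha> q = - (\<epsilon> q * c1 q)" "e q \<alpha> = - \<epsilon> q * e q c1" "f q \<alpha> = - \<epsilon> q * f q c1"
      using al[OF q] by auto
    have PQ: "P q = 0" "Q q = 0" using tr[OF q] trace_zero_iff[OF q] by auto
    show "lie_bracket A \<xi> e q = - (\<epsilon> q * c1 q) *\<^sub>R e q + (c3 q - c1 q + 1) *\<^sub>R f q"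
      unfolding bracket_reeb_e[OF q] al gb ..
    show "lie_bracket A \<xi> f q = (c3 q + c1 q + 1) *\<^sub>R e q + (\<epsilon> q * c1 q) *\<^sub>R f q"
      unfolding bracket_reeb_f'[OF q] al gb minus_minus ..
    show "lie_bracket A e f q = - 2 *\<^sub>R \<xi> q + a4 q *\<^sub>R e q - a5 q *\<^sub>R f q"
      unfolding bracket_e_f[OF q] by simp
    have eg: "e q \<gamma> = e q c3 + e q c1" "e q \<beta> = e q c3 - e q c1"
      "f q \<gamma> = f q c3 + f q c1" "f q \<beta> = f q c3 - f q c1"
      unfolding d by (simp_all add: field_simps)
    \<comment> \<open>\<open>Q\<close> becomes exactly the left side of the third equation. The
      Jacobi relations for \<open>a4\<close> and \<open>a5\<close> then make the left sides of the
      other two equal to 1 and \<open>- \<epsilon>\<close> times it.\<close>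
    have T: "e q c1 + \<epsilon> q * f q c1 + 2 * \<epsilon> q * c1 q * a4 q + 2 * c1 q * a5 q = 0"
      using PQ(2) unfolding Q_def eg gb al by (simp add: algebra_simps)
    then show "(e q + \<epsilon> q *\<^sub>R f q) c1 + 2 * \<epsilon> q * c1 q * a4 q + 2 * c1 q * a5 q = 0"
      by (simp add: scaleR_fun_def)
    show "\<xi> q a4 - e q c3 + \<epsilon> q * c1 q * a4 q - a5 q * (c3 q - c1 q + 1) = 0"
      unfolding reeb_a4[OF q] eg gb al using T by (simp add: algebra_simps)
    have "\<xi> q a5 - f q c3 - \<epsilon> q * c1 q * a5 q - a4 q * (c3 q + c1 q + 1) =
        - \<epsilon> q * (e q c1 + \<epsilon> q * f q c1 + 2 * \<epsilon> q * c1 q * a4 q + 2 * c1 q * a5 q)"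
      unfolding reeb_a5[OF q] eg gb al using eps[of q] by algebra
    then show "\<xi> q a5 - f q c3 - \<epsilon> q * c1 q * a5 q - a4 q * (c3 q + c1 q + 1) = 0"
      unfolding T by simp
  qed
  then show ?thesis by blast
qed

text \<open>Uniqueness of frame coefficients identifies the given functions with the structure
  functions. Where \<epsilon> is locally constant, \<open>Q\<close> and \<open>P\<close> equal 1 and
  \<epsilon> times the left side of the third equation; being continuous, they vanish on all of
  \<open>U\<close> by density.\<close>

lemma trace_zero_if_described:
  assumes D: "described \<epsilon> c1 c3 c4 c5" and q: "q \<in> U"
  shows "trace q = 0"
proof -
  have sign: "local_sign U \<epsilon>" and c: "smooth_fun A U c1" "smooth_fun A U c3"
    using D by (simp_all add: described_def)
  have st: "\<alpha> x = - (\<epsilon> x * c1 x)" "\<beta> x = c3 x - c1 x + 1" "\<gamma> x = c3 x + c1 x + 1"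
    "a4 x = c4 x" "a5 x = c5 x" if x: "x \<in> U" for x
  proof -
    have *: "lie_bracket A \<xi> e x = 0 *\<^sub>R \<xi> x + (- (\<epsilon> x * c1 x)) *\<^sub>R e x + (c3 x - c1 x + 1) *\<^sub>R f x"
      "lie_bracket A \<xi> f x = 0 *\<^sub>R \<xi> x + (c3 x + c1 x + 1) *\<^sub>R e x + (\<epsilon> x * c1 x) *\<^sub>R f x"
      "lie_bracket A e f x = (- 2) *\<^sub>R \<xi> x + c4 x *\<^sub>R e x + (- c5 x) *\<^sub>R f x"
      using D x by (simp_all add: described_def)
    show "\<alpha> x = - (\<epsilon> x * c1 x)" "\<beta> x = c3 x - c1 x + 1" "\<gamma> x = c3 x + c1 x + 1"
      "a4 x = c4 x" "a5 x = c5 x"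
      using metric_frame_combination[OF x *(1)] metric_frame_combination[OF x *(2)]
        metric_frame_combination[OF x *(3)]
      by (simp_all add: \<alpha>_def \<beta>_def \<gamma>_def a4_def a5_def)
  qed
  have dst: "w \<beta> = w c3 - w c1" "w \<gamma> = w c3 + w c1" if x: "x \<in> U" and w: "w \<in> tangent_space A x" for x w
  proof -
    have "w \<beta> = w (\<lambda>x. 1 * c3 x + (- 1) * c1 x + 1)" "w \<gamma> = w (\<lambda>x. 1 * c3 x + 1 * c1 x + 1)"
      by (rule tangent_cong[OF w open_U x], simp add: st)+
    then show "w \<beta> = w c3 - w c1" "w \<gamma> = w c3 + w c1"
      unfolding tangent_combination[OF x w c(2,1)] by simp_all
  qed
  obtain W where W: "open W" "W \<subseteq> U" "U \<subseteq> closure W"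
      "\<And>p. p \<in> W \<Longrightarrow> \<exists>N. open N \<and> p \<in> N \<and> N \<subseteq> W \<and> (\<forall>q\<in>N. \<epsilon> q = \<epsilon> p)"
    using sign unfolding local_sign_def by blast
  have eps: "\<epsilon> x * \<epsilon> x = 1" if "x \<in> U" for x
    using sign that unfolding local_sign_def by fastforce
  have PQ: "P x = 0 \<and> Q x = 0" if x: "x \<in> W" for x
  proof -
    have xU: "x \<in> U" using x W by blast
    note t = frame_tangent[OF xU]
    obtain N where N: "open N" "x \<in> N" "N \<subseteq> W" "\<And>y. y \<in> N \<Longrightarrow> \<epsilon> y = \<epsilon> x" using W(4)[OF x] by blast
    have da: "w \<alpha> = - \<epsilon> x * w c1" if w: "w \<in> tangent_space A x" for w
    proof -
      have "w \<alpha> = w (\<lambda>y. (- \<epsilon> x) * c1 y)"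
      proof (rule tangent_cong[OF w N(1,2)])
        fix y assume y: "y \<in> N"
        then have "y \<in> U" using N(3) W(2) by blast
        then show "\<alpha> y = - \<epsilon> x * c1 y" using st(1) N(4)[OF y] by simp
      qed
      then show ?thesis unfolding tangent_fun_cmult[OF w open_U xU c(1)] .
    qed
    have T: "e x c1 + \<epsilon> x * f x c1 + 2 * \<epsilon> x * c1 x * c4 x + 2 * c1 x * c5 x = 0"
      using D xU by (simp add: described_def scaleR_fun_def)
    have 1: "(f x \<gamma> - f x \<beta>) / 2 = f x c1" "(e x \<gamma> - e x \<beta>) / 2 = e x c1" "\<gamma> x - \<beta> x = 2 * c1 x"
      using dst[OF xU t(2)] dst[OF xU t(3)] st[OF xU] by simp_all
    have "Q x = e x c1 + \<epsilon> x * f x c1 + 2 * \<epsilon> x * c1 x * c4 x + 2 * c1 x * c5 x"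
      unfolding Q_def 1 da[OF t(3)] st(1,4,5)[OF xU] by simp
    moreover have "P x = \<epsilon> x * (e x c1 + \<epsilon> x * f x c1 + 2 * \<epsilon> x * c1 x * c4 x + 2 * c1 x * c5 x)"
      unfolding P_def 1 da[OF t(2)] st(1,4,5)[OF xU] using eps[OF xU] by algebra
    ultimately show ?thesis using T by simp
  qed
  have dense: "\<exists>x\<in>S. x \<in> W" if "open S" "q \<in> S" for S
    using open_Int_closure_eq_empty[OF that(1), of W] that(2) W(3) q by blast
  have "P q = 0" "Q q = 0"
    using smooth_zero_at_limit[OF open_U q P_smooth] smooth_zero_at_limit[OF open_U q Q_smooth]
      dense PQ by metis+
  \<comment> \<open>This coefficient contains no derivatives, so it suffices that \<epsilon> squares
    to 1 at the point itself.\<close>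
  moreover have "(\<gamma> q - \<beta> q)\<^sup>2 = 4 * (\<alpha> q)\<^sup>2"
    unfolding st[OF q] using eps[OF q] by algebra
  ultimately show ?thesis unfolding trace_zero_iff[OF q] by blast
qed

end

section \<open>From local frames to the equivalence on the manifold\<close>

context paracontact_manifold
begin

text \<open>By \<open>trace_any_frame\<close>, the trace in an arbitrary frame agrees at each point
  with the trace in any \<phi>-basis around it, so a description in one \<phi>-basis near each point
  controls every frame.\<close>

lemma harmonic_iff:
  "infinitesimal_harmonic_transformation A g nabla \<xi> \<longleftrightarrow>
    (\<forall>p. \<exists>U e \<epsilon> c1 c3 c4 c5. p \<in> U \<and> phi_basis A \<phi> \<xi> g U e \<and>
      phi_frame.described A \<phi> \<xi> U e \<epsilon> c1 c3 c4 c5)"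
proof
  assume H: "infinitesimal_harmonic_transformation A g nabla \<xi>"
  show "\<forall>p. \<exists>U e \<epsilon> c1 c3 c4 c5. p \<in> U \<and> phi_basis A \<phi> \<xi> g U e \<and>
      phi_frame.described A \<phi> \<xi> U e \<epsilon> c1 c3 c4 c5"
  proof
    fix p
    obtain U e where U: "p \<in> U" "phi_basis A \<phi> \<xi> g U e" using phi_basis_ex by blast
    interpret phi_frame A g nabla \<phi> \<xi> \<eta> U e by unfold_locales (rule U(2))
    have "trace q = 0" if "q \<in> U" for q
      unfolding trace_any_frame[OF pseudo_orthonormal that that, symmetric]
      by (rule H[unfolded infinitesimal_harmonic_transformation_def, rule_format,
            OF pseudo_orthonormal that])
    then show "\<exists>U e \<epsilon> c1 c3 c4 c5. p \<in> U \<and> phi_basis A \<phi> \<xi> g U e \<and>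
        phi_frame.described A \<phi> \<xi> U e \<epsilon> c1 c3 c4 c5"
      using described_if_trace_zero U by blast
  qed
next
  assume D: "\<forall>p. \<exists>U e \<epsilon> c1 c3 c4 c5. p \<in> U \<and> phi_basis A \<phi> \<xi> g U e \<and>
      phi_frame.described A \<phi> \<xi> U e \<epsilon> c1 c3 c4 c5"
  show "infinitesimal_harmonic_transformation A g nabla \<xi>"
    unfolding infinitesimal_harmonic_transformation_def
  proof (intro allI impI ballI)
    fix U' F s p assume F: "pseudo_orthonormal_frame A g U' F s" and p: "p \<in> U'"
    obtain U e \<epsilon> c1 c3 c4 c5 where U: "p \<in> U" "phi_basis A \<phi> \<xi> g U e"
        and d: "phi_frame.described A \<phi> \<xi> U e \<epsilon> c1 c3 c4 c5"
      using D[THEN spec, of p] by (elim exE conjE) (rule that)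
    interpret phi_frame A g nabla \<phi> \<xi> \<eta> U e by unfold_locales (rule U(2))
    show "(\<Sum>i\<in>UNIV. s i *\<^sub>R lie_deriv_connection A nabla \<xi> (F i) (F i) p) = 0"
      unfolding trace_any_frame[OF F U(1) p] by (rule trace_zero_if_described[OF d U(1)])
  qed
qed

end

theorem proposition3p2:
  fixes A :: "('a::{t2_space,second_countable_topology}) chart set"
    and \<phi> :: "'a \<Rightarrow> 'a tvec \<Rightarrow> 'a tvec"
    and \<xi> :: "'a vfield"
    and \<eta> :: "'a \<Rightarrow> 'a tvec \<Rightarrow> real"
    and g :: "'a \<Rightarrow> 'a tvec \<Rightarrow> 'a tvec \<Rightarrow> real"
    and nabla :: "'a vfield \<Rightarrow> 'a vfield \<Rightarrow> 'a vfield"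
  assumes "paracontact_metric_manifold A \<phi> \<xi> \<eta> g"
    and "levi_civita A g nabla"
  shows "infinitesimal_harmonic_transformation A g nabla \<xi> \<longleftrightarrow>
    (\<forall>p. \<exists>U e \<phi>e \<epsilon> a1 a3 a4 a5.
       open U \<and> p \<in> U \<and> phi_basis A \<phi> \<xi> g U e \<and> \<phi>e = (\<lambda>q. \<phi> q (e q)) \<and> local_sign U \<epsilon> \<and>
       smooth_fun A U a1 \<and> smooth_fun A U a3 \<and> smooth_fun A U a4 \<and> smooth_fun A U a5 \<and>
       (\<forall>q\<in>U.
          lie_bracket A \<xi> e q = - (\<epsilon> q * a1 q) *\<^sub>R e q + (a3 q - a1 q + 1) *\<^sub>R \<phi>e q \<and>
          lie_bracket A \<xi> \<phi>e q = (a3 q + a1 q + 1) *\<^sub>R e q + (\<epsilon> q * a1 q) *\<^sub>R \<phi>e q \<and>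
          lie_bracket A e \<phi>e q = - 2 *\<^sub>R \<xi> q + a4 q *\<^sub>R e q - a5 q *\<^sub>R \<phi>e q \<and>
          \<xi> q a4 - e q a3 + \<epsilon> q * a1 q * a4 q - a5 q * (a3 q - a1 q + 1) = 0 \<and>
          \<xi> q a5 - \<phi>e q a3 - \<epsilon> q * a1 q * a5 q - a4 q * (a3 q + a1 q + 1) = 0 \<and>
          (e q + \<epsilon> q *\<^sub>R \<phi>e q) a1 + 2 * \<epsilon> q * a1 q * a4 q + 2 * a1 q * a5 q = 0))"
proof -
  interpret paracontact_manifold A g nabla \<phi> \<xi> \<eta>
    using assms by unfold_locales (simp_all add: paracontact_metric_manifold_def)
  \<comment> \<open>Outside the frame locale the predicate is spelled out with
    \<open>\<phi> e\<close> in place of \<open>f\<close>, to match the statement.\<close>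
  have described: "phi_frame.described A \<phi> \<xi> U e \<epsilon> c1 c3 c4 c5 \<longleftrightarrow> local_sign U \<epsilon> \<and>
     smooth_fun A U c1 \<and> smooth_fun A U c3 \<and> smooth_fun A U c4 \<and> smooth_fun A U c5 \<and>
     (\<forall>q\<in>U.
        lie_bracket A \<xi> e q = - (\<epsilon> q * c1 q) *\<^sub>R e q + (c3 q - c1 q + 1) *\<^sub>R \<phi> q (e q) \<and>
        lie_bracket A \<xi> (\<lambda>q. \<phi> q (e q)) q =
          (c3 q + c1 q + 1) *\<^sub>R e q + (\<epsilon> q * c1 q) *\<^sub>R \<phi> q (e q) \<and>
        lie_bracket A e (\<lambda>q. \<phi> q (e q)) q =
          - 2 *\<^sub>R \<xi> q + c4 q *\<^sub>R e q - c5 q *\<^sub>R \<phi> q (e q) \<and>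
        \<xi> q c4 - e q c3 + \<epsilon> q * c1 q * c4 q - c5 q * (c3 q - c1 q + 1) = 0 \<and>
        \<xi> q c5 - \<phi> q (e q) c3 - \<epsilon> q * c1 q * c5 q - c4 q * (c3 q + c1 q + 1) = 0 \<and>
        (e q + \<epsilon> q *\<^sub>R \<phi> q (e q)) c1 + 2 * \<epsilon> q * c1 q * c4 q + 2 * c1 q * c5 q = 0)"
    if "phi_basis A \<phi> \<xi> g U e" for U e \<epsilon> c1 c3 c4 c5
  proof -
    interpret phi_frame A g nabla \<phi> \<xi> \<eta> U e by unfold_locales (rule that)
    show ?thesis unfolding described_def f_def ..
  qed
  have open_basis: "open U" if "phi_basis A \<phi> \<xi> g U e" for U e
    using that by (simp add: phi_basis_def)
  show ?thesis
    unfolding harmonic_iff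
  proof (intro iff_allI iffI, goal_cases)
    case (1 p)
    then obtain U e \<epsilon> c1 c3 c4 c5 where 2: "p \<in> U" "phi_basis A \<phi> \<xi> g U e"
        "phi_frame.described A \<phi> \<xi> U e \<epsilon> c1 c3 c4 c5"
      by (elim exE conjE) (rule that)
    show ?case
      by (rule exI[of _ U], rule exI[of _ e], rule exI[of _ "\<lambda>q. \<phi> q (e q)"], rule exI[of _ \<epsilon>],
          rule exI[of _ c1], rule exI[of _ c3], rule exI[of _ c4], rule exI[of _ c5],
          intro conjI[OF open_basis[OF 2(2)] conjI[OF 2(1) conjI[OF 2(2) conjI[OF refl]]]])
        (rule described[OF 2(2), THEN iffD1, OF 2(3)])
  next
    case (2 p)
    then obtain U e \<phi>e \<epsilon> c1 c3 c4 c5 where 3: "p \<in> U" "phi_basis A \<phi> \<xi> g U e"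
        and e: "\<phi>e = (\<lambda>q. \<phi> q (e q))"
        and 4: "local_sign U \<epsilon> \<and>
          smooth_fun A U c1 \<and> smooth_fun A U c3 \<and> smooth_fun A U c4 \<and> smooth_fun A U c5 \<and>
          (\<forall>q\<in>U.
            lie_bracket A \<xi> e q = - (\<epsilon> q * c1 q) *\<^sub>R e q + (c3 q - c1 q + 1) *\<^sub>R \<phi>e q \<and>
            lie_bracket A \<xi> \<phi>e q = (c3 q + c1 q + 1) *\<^sub>R e q + (\<epsilon> q * c1 q) *\<^sub>R \<phi>e q \<and>
            lie_bracket A e \<phi>e q = - 2 *\<^sub>R \<xi> q + c4 q *\<^sub>R e q - c5 q *\<^sub>R \<phi>e q \<and>
            \<xi> q c4 - e q c3 + \<epsilon> q * c1 q * c4 q - c5 q * (c3 q - c1 q + 1) = 0 \<and>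
            \<xi> q c5 - \<phi>e q c3 - \<epsilon> q * c1 q * c5 q - c4 q * (c3 q + c1 q + 1) = 0 \<and>
            (e q + \<epsilon> q *\<^sub>R \<phi>e q) c1 + 2 * \<epsilon> q * c1 q * c4 q + 2 * c1 q * c5 q = 0)"
      by (elim exE conjE) (rule that, assumption+, intro conjI)
    have "phi_frame.described A \<phi> \<xi> U e \<epsilon> c1 c3 c4 c5"
      using 4 unfolding described[OF 3(2)] e .
    then show ?case using 3 by blast
  qed
qed

end
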